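(* Let $\mathcal{B},\mathcal{B}'$ be decorated bicategories. Let $G:\mathcal{B}\to\mathcal{B}'$ be a decorated pseudofunctor. Then the free double functor $Q_G$ associated to $G$ is the unique double functor from $Q_{\mathcal{B}}$ to $Q_{\mathcal{B}'}$ satisfying the equation $H^*Q_G\restriction_{\mathcal{B}}=G$.
   Context: Double categories. A double category $C$ (possibly weak in the horizontal direction) consists of a category $C_0$ (objects and vertical morphisms), a category $C_1$ (horizontal morphisms and squares; composition in $C_1$ is vertical composition, written $\bullet$), functors $s,t:C_1\to C_0$ (left and right edge), a horizontal identity functor $i:C_0\to C_1$ (its value on a vertical morphism $f$ is the square $i_f$), a horizontal composition functor $*:C_1\times_{C_0}C_1\to C_1$ (the composite of $\Phi$ followed on its right by $\Psi$ is written $\Psi*\Phi$), and invertible globular associator and left/right unitor natural transformations satisfying the usual coherence axioms. A square is globular if its left and right edges are identity vertical morphisms. $HC$ denotes the horizontal bicategory of $C$: 0-cells, 1-cells, 2-cells are the objects, horizontal morphisms, globular squares of $C$. A double functor $F:C\to C'$ is a pair of functors $F_0:C_0\to C_0'$, $F_1:C_1\to C_1'$ commuting with $s,t$ and compatible with $i$ and $*$ up to specified coherent invertible globular squares (its coherence data). Decorated bicategories. A decorated bicategory $\mathcal{B}$ is a bicategory (also written $\mathcal{B}$) together with a category $\mathcal{B}^*$ (the decoration) whose objects are the 0-cells of $\mathcal{B}$. A decorated pseudofunctor $G:\mathcal{B}\to\mathcal{B}'$ is a pseudofunctor together with a functor $G^*:\mathcal{B}^*\to\mathcal{B}'^*$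 agreeing with it on 0-cells. For a double category $C$, $H^*C$ is $HC$ decorated by $C_0$; for a double functor $F$, $H^*F$ is the decorated pseudofunctor given by $F_0$ and the restriction of $F$ (with its coherence data) to horizontal morphisms and globular squares. The free globularly generated double category $Q_{\mathcal{B}}$. Let $\mathbb{G}$ be the collection of formal squares of two kinds: for every 2-cell $\varphi:\alpha\Rightarrow\beta$ of $\mathcal{B}$ with $\alpha,\beta:a\to b$, a square $\varphi$ with top $\alpha$, bottom $\beta$, left edge $id_a$, right edge $id_b$; and for every morphism $f:a\to b$ of $\mathcal{B}^*$, a square $i_f$ with top the identity 1-cell $i_a$, bottom $i_b$, left and right edges $f$. The squares $i_{id_a}$ and $id_{i_a}$ are regarded as equal. Form all formal expressions obtained from $\mathbb{G}$ by formal vertical composition $\Psi\bullet\Phi$ (when the bottom of $\Phi$ equals the top of $\Psi$; left and right edges compose in $\mathcal{B}^*$) and formal parenthesized horizontal composition $\Psi*\Phi$ (when the right edge of $\Phi$ equals the left edge of $\Psi$; tops and bottoms compose as 1-cells of $\mathcal{B}$). Then $Q_{\mathcal{B}}$ has $\mathcal{B}^*$ as category of objects, the 1-cells of $\mathcal{B}$ (with their composition and identities) as horizontal morphisms, and as squares the expressions modulo the smallest equivalence relation compatible with $\bullet$ and $*$ such that: $\bullet$ is associative and the identity 2-cell $id_\alpha$ is a vertical identity at $\alpha$; (1) $(\Psi_2\bullet\Psi_1)*(\Phi_2\bullet\Phi_1)\sim(\Psi_2*\Phi_2)\bullet(\Psi_1*\Phi_1)$ whenever both sides make sense; (2) for vertically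 composable 2-cells of $\mathcal{B}$ the formal composite $\psi\bullet\varphi$ is identified with their vertical composite in $\mathcal{B}$, and $i_g\bullet i_f\sim i_{gf}$ for composable $f,g$ in $\mathcal{B}^*$; (3) for horizontally composable 2-cells of $\mathcal{B}$ the formal composite $\psi*\varphi$ is identified with their horizontal composite in $\mathcal{B}$; (4) the left and right unitors of $\mathcal{B}$ are natural with respect to all squares; (5) the associators of $\mathcal{B}$ are natural with respect to all squares. Horizontal identities are the $i_f$; associators and unitors are those of $\mathcal{B}$. $\mathcal{B}$ is a sub-decorated bicategory of $H^*Q_{\mathcal{B}}$ via the inclusion $j^{\mathcal{B}}$ that is the identity on $\mathcal{B}^*$ and 1-cells and sends each 2-cell to its class. The free double functor $Q_G$. $Q_G$ is the pair consisting of $G^*:\mathcal{B}^*\to\mathcal{B}'^*$ on objects and vertical morphisms and of the functor on categories of squares which equals $G$ on 1-cells, is given on generators by $\varphi\mapsto G\varphi$ for 2-cells $\varphi$ of $\mathcal{B}$ and $i_f\mapsto i_{G^*f}$ for morphisms $f$ of $\mathcal{B}^*$, and is extended recursively to all expressions compatibly with vertical and horizontal composition (the coherence data of $G$ serving as coherence data of $Q_G$). The equation $H^*Q_G\restriction_{\mathcal{B}}=G$ means $H^*Q_G\circ j^{\mathcal{B}}=j^{\mathcal{B}'}\circ G$ as decorated pseudofunctors.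
   Formalization: Since i_{G*f} has the wrong top and bottom when G is not strictly unital, Q_G(i_f) is taken to be i_{G*f} conjugated by the unit coherence cells of G, and Q_G(Ψ*Φ) to be Q_GΨ*Q_GΦ conjugated by its composition coherence cells. *)

theory Defs
  imports Main
begin

text \<open>
  All structures are given by carrier sets and total operations whose values are constrained on
  the carriers only; accordingly, functors are compared on carriers.  Binary compositions are
  written in applicative order: the right-hand argument comes first.
\<close>

subsection \<open>Categories and functors\<close>

record ('o, 'a) cat =
  Obj :: "'o set"
  Arr :: "'a set"
  Dom :: "'a \<Rightarrow> 'o"
  Cod :: "'a \<Rightarrow> 'o"
  Idn :: "'o \<Rightarrow> 'a"
  Comp :: "'a \<Rightarrow> 'a \<Rightarrow> 'a"

definition in_hom :: "('o, 'a) cat \<Rightarrow> 'a \<Rightarrow> 'o \<Rightarrow> 'o \<Rightarrow> bool" where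
  "in_hom C f a b \<longleftrightarrow> f \<in> Arr C \<and> Dom C f = a \<and> Cod C f = b"

locale category =
  fixes C :: "('o, 'a) cat"
  assumes Dom_Obj: "f \<in> Arr C \<Longrightarrow> Dom C f \<in> Obj C"
    and Cod_Obj: "f \<in> Arr C \<Longrightarrow> Cod C f \<in> Obj C"
    and Idn_hom: "a \<in> Obj C \<Longrightarrow> in_hom C (Idn C a) a a"
    and Comp_hom: "in_hom C f a b \<Longrightarrow> in_hom C g b c \<Longrightarrow> in_hom C (Comp C g f) a c"
    and Idn_left: "f \<in> Arr C \<Longrightarrow> Comp C (Idn C (Cod C f)) f = f"
    and Idn_right: "f \<in> Arr C \<Longrightarrow> Comp C f (Idn C (Dom C f)) = f"
    and Comp_assoc: "in_hom C f a b \<Longrightarrow> in_hom C g b c \<Longrightarrow> in_hom C h c d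
      \<Longrightarrow> Comp C (Comp C h g) f = Comp C h (Comp C g f)"

definition inverse_arrows :: "('o, 'a) cat \<Rightarrow> 'a \<Rightarrow> 'a \<Rightarrow> bool" where
  "inverse_arrows C f g \<longleftrightarrow> in_hom C f (Dom C f) (Cod C f) \<and> in_hom C g (Cod C f) (Dom C f)
     \<and> Comp C g f = Idn C (Dom C f) \<and> Comp C f g = Idn C (Cod C f)"

definition invertible_arrow :: "('o, 'a) cat \<Rightarrow> 'a \<Rightarrow> bool" where
  "invertible_arrow C f \<longleftrightarrow> (\<exists>g. inverse_arrows C f g)"

definition inverse_arrow :: "('o, 'a) cat \<Rightarrow> 'a \<Rightarrow> 'a" where
  "inverse_arrow C f = (THE g. inverse_arrows C f g)"

locale cat_functor = S: category C + T: category D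
  for C :: "('o, 'a) cat" and D :: "('p, 'b) cat" +
  fixes Fo :: "'o \<Rightarrow> 'p" and Fa :: "'a \<Rightarrow> 'b"
  assumes map_Obj: "a \<in> Obj C \<Longrightarrow> Fo a \<in> Obj D"
    and map_hom: "in_hom C f a b \<Longrightarrow> in_hom D (Fa f) (Fo a) (Fo b)"
    and map_Idn: "a \<in> Obj C \<Longrightarrow> Fa (Idn C a) = Idn D (Fo a)"
    and map_Comp: "in_hom C f a b \<Longrightarrow> in_hom C g b c \<Longrightarrow> Fa (Comp C g f) = Comp D (Fa g) (Fa f)"

definition prod_cat :: "('o, 'a) cat \<Rightarrow> ('p, 'b) cat \<Rightarrow> ('o \<times> 'p, 'a \<times> 'b) cat" where
  "prod_cat C D = \<lparr>Obj = Obj C \<times> Obj D, Arr = Arr C \<times> Arr D,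
     Dom = map_prod (Dom C) (Dom D), Cod = map_prod (Cod C) (Cod D),
     Idn = map_prod (Idn C) (Idn D),
     Comp = (\<lambda>(g, g') (f, f'). (Comp C g f, Comp D g' f'))\<rparr>"


subsection \<open>Bicategories and decorated bicategories\<close>

text \<open>
  The field \<open>Hom\<close> is the disjoint union of all hom-categories: its objects are the 1-cells and its
  arrows the 2-cells, composed vertically.  Thus for \<open>\<alpha> : a \<rightarrow> b\<close> and \<open>\<beta> : b \<rightarrow> c\<close> the composite
  1-cell is \<open>\<beta> \<odot> \<alpha>\<close>, and \<open>\<otimes>\<close> is horizontal composition of 2-cells.
\<close>

record ('o, 'h, 's) bicat =
  Cell0 :: "'o set"
  Hom :: "('h, 's) cat"
  Src :: "'h \<Rightarrow> 'o"
  Tgt :: "'h \<Rightarrow> 'o"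
  Unit1 :: "'o \<Rightarrow> 'h"
  HComp1 :: "'h \<Rightarrow> 'h \<Rightarrow> 'h"  (infixr "\<odot>\<index>" 70)
  HComp2 :: "'s \<Rightarrow> 's \<Rightarrow> 's"  (infixr "\<otimes>\<index>" 70)
  Assoc :: "'h \<Rightarrow> 'h \<Rightarrow> 'h \<Rightarrow> 's"
  LUnit :: "'h \<Rightarrow> 's"
  RUnit :: "'h \<Rightarrow> 's"

abbreviation Cell1 :: "('o, 'h, 's, 'z) bicat_scheme \<Rightarrow> 'h set" where
  "Cell1 B \<equiv> Obj (Hom B)"

abbreviation Cell2 :: "('o, 'h, 's, 'z) bicat_scheme \<Rightarrow> 's set" where
  "Cell2 B \<equiv> Arr (Hom B)"

abbreviation VComp2 :: "('o, 'h, 's, 'z) bicat_scheme \<Rightarrow> 's \<Rightarrow> 's \<Rightarrow> 's"  (infixr "\<cdot>\<index>" 65) where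
  "VComp2 B \<psi> \<phi> \<equiv> Comp (Hom B) \<psi> \<phi>"

abbreviation Id2 :: "('o, 'h, 's, 'z) bicat_scheme \<Rightarrow> 'h \<Rightarrow> 's" where
  "Id2 B \<alpha> \<equiv> Idn (Hom B) \<alpha>"

definition composable1 :: "('o, 'h, 's, 'z) bicat_scheme \<Rightarrow> 'h \<Rightarrow> 'h \<Rightarrow> bool" where
  "composable1 B \<beta> \<alpha> \<longleftrightarrow> \<beta> \<in> Cell1 B \<and> \<alpha> \<in> Cell1 B \<and> Src B \<beta> = Tgt B \<alpha>"

definition composable2 :: "('o, 'h, 's, 'z) bicat_scheme \<Rightarrow> 's \<Rightarrow> 's \<Rightarrow> bool" where
  "composable2 B \<psi> \<phi> \<longleftrightarrow> \<psi> \<in> Cell2 B \<and> \<phi> \<in> Cell2 B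
     \<and> composable1 B (Dom (Hom B) \<psi>) (Dom (Hom B) \<phi>)"

definition hom_cat :: "('o, 'h, 's, 'z) bicat_scheme \<Rightarrow> 'o \<Rightarrow> 'o \<Rightarrow> ('h, 's) cat" where
  "hom_cat B a b = (Hom B)
     \<lparr>Obj := {\<alpha> \<in> Cell1 B. Src B \<alpha> = a \<and> Tgt B \<alpha> = b},
      Arr := {\<phi> \<in> Cell2 B. Src B (Dom (Hom B) \<phi>) = a \<and> Tgt B (Dom (Hom B) \<phi>) = b}\<rparr>"

locale bicategory =
  fixes B :: "('o, 'h, 's, 'z) bicat_scheme"
  assumes Hom_category: "category (Hom B)"
    and Src_Cell0: "\<alpha> \<in> Cell1 B \<Longrightarrow> Src B \<alpha> \<in> Cell0 B"
    and Tgt_Cell0: "\<alpha> \<in> Cell1 B \<Longrightarrow> Tgt B \<alpha> \<in> Cell0 B"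
    and parallel: "\<phi> \<in> Cell2 B \<Longrightarrow>
      Src B (Dom (Hom B) \<phi>) = Src B (Cod (Hom B) \<phi>) \<and>
      Tgt B (Dom (Hom B) \<phi>) = Tgt B (Cod (Hom B) \<phi>)"
    and Unit1_Cell1: "a \<in> Cell0 B \<Longrightarrow>
      Unit1 B a \<in> Cell1 B \<and> Src B (Unit1 B a) = a \<and> Tgt B (Unit1 B a) = a"
    and HComp_functor: "a \<in> Cell0 B \<Longrightarrow> b \<in> Cell0 B \<Longrightarrow> c \<in> Cell0 B \<Longrightarrow>
      cat_functor (prod_cat (hom_cat B b c) (hom_cat B a b)) (hom_cat B a c)
        (\<lambda>(\<beta>, \<alpha>). \<beta> \<odot>\<^bsub>B\<^esub> \<alpha>) (\<lambda>(\<psi>, \<phi>). \<psi> \<otimes>\<^bsub>B\<^esub> \<phi>)"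
    and Assoc_hom: "composable1 B \<gamma> \<beta> \<Longrightarrow> composable1 B \<beta> \<alpha> \<Longrightarrow>
      in_hom (Hom B) (Assoc B \<gamma> \<beta> \<alpha>) ((\<gamma> \<odot>\<^bsub>B\<^esub> \<beta>) \<odot>\<^bsub>B\<^esub> \<alpha>) (\<gamma> \<odot>\<^bsub>B\<^esub> (\<beta> \<odot>\<^bsub>B\<^esub> \<alpha>))"
    and Assoc_invertible: "composable1 B \<gamma> \<beta> \<Longrightarrow> composable1 B \<beta> \<alpha> \<Longrightarrow>
      invertible_arrow (Hom B) (Assoc B \<gamma> \<beta> \<alpha>)"
    and Assoc_natural: "composable2 B \<xi> \<psi> \<Longrightarrow> composable2 B \<psi> \<phi> \<Longrightarrow>
      Assoc B (Cod (Hom B) \<xi>) (Cod (Hom B) \<psi>) (Cod (Hom B) \<phi>) \<cdot>\<^bsub>B\<^esub> ((\<xi> \<otimes>\<^bsub>B\<^esub> \<psi>) \<otimes>\<^bsub>B\<^esub> \<phi>)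
      = (\<xi> \<otimes>\<^bsub>B\<^esub> (\<psi> \<otimes>\<^bsub>B\<^esub> \<phi>)) \<cdot>\<^bsub>B\<^esub> Assoc B (Dom (Hom B) \<xi>) (Dom (Hom B) \<psi>) (Dom (Hom B) \<phi>)"
    and LUnit_hom: "\<alpha> \<in> Cell1 B \<Longrightarrow>
      in_hom (Hom B) (LUnit B \<alpha>) (Unit1 B (Tgt B \<alpha>) \<odot>\<^bsub>B\<^esub> \<alpha>) \<alpha>"
    and LUnit_invertible: "\<alpha> \<in> Cell1 B \<Longrightarrow> invertible_arrow (Hom B) (LUnit B \<alpha>)"
    and LUnit_natural: "in_hom (Hom B) \<phi> \<alpha> \<beta> \<Longrightarrow>
      LUnit B \<beta> \<cdot>\<^bsub>B\<^esub> (Id2 B (Unit1 B (Tgt B \<alpha>)) \<otimes>\<^bsub>B\<^esub> \<phi>) = \<phi> \<cdot>\<^bsub>B\<^esub> LUnit B \<alpha>"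
    and RUnit_hom: "\<alpha> \<in> Cell1 B \<Longrightarrow>
      in_hom (Hom B) (RUnit B \<alpha>) (\<alpha> \<odot>\<^bsub>B\<^esub> Unit1 B (Src B \<alpha>)) \<alpha>"
    and RUnit_invertible: "\<alpha> \<in> Cell1 B \<Longrightarrow> invertible_arrow (Hom B) (RUnit B \<alpha>)"
    and RUnit_natural: "in_hom (Hom B) \<phi> \<alpha> \<beta> \<Longrightarrow>
      RUnit B \<beta> \<cdot>\<^bsub>B\<^esub> (\<phi> \<otimes>\<^bsub>B\<^esub> Id2 B (Unit1 B (Src B \<alpha>))) = \<phi> \<cdot>\<^bsub>B\<^esub> RUnit B \<alpha>"
    and pentagon: "composable1 B \<delta> \<gamma> \<Longrightarrow> composable1 B \<gamma> \<beta> \<Longrightarrow> composable1 B \<beta> \<alpha> \<Longrightarrow>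
      Assoc B \<delta> \<gamma> (\<beta> \<odot>\<^bsub>B\<^esub> \<alpha>) \<cdot>\<^bsub>B\<^esub> Assoc B (\<delta> \<odot>\<^bsub>B\<^esub> \<gamma>) \<beta> \<alpha>
      = (Id2 B \<delta> \<otimes>\<^bsub>B\<^esub> Assoc B \<gamma> \<beta> \<alpha>) \<cdot>\<^bsub>B\<^esub> Assoc B \<delta> (\<gamma> \<odot>\<^bsub>B\<^esub> \<beta>) \<alpha> \<cdot>\<^bsub>B\<^esub> (Assoc B \<delta> \<gamma> \<beta> \<otimes>\<^bsub>B\<^esub> Id2 B \<alpha>)"
    and triangle: "composable1 B \<beta> \<alpha> \<Longrightarrow>
      (Id2 B \<beta> \<otimes>\<^bsub>B\<^esub> LUnit B \<alpha>) \<cdot>\<^bsub>B\<^esub> Assoc B \<beta> (Unit1 B (Tgt B \<alpha>)) \<alpha> = RUnit B \<beta> \<otimes>\<^bsub>B\<^esub> Id2 B \<alpha>"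

record ('o, 'h, 's, 'v) dec_bicat = "('o, 'h, 's) bicat" +
  Dec :: "('o, 'v) cat"

locale decorated_bicategory = bicategory B + Dec: category "Dec B"
  for B :: "('o, 'h, 's, 'v) dec_bicat" +
  assumes Dec_Obj: "Obj (Dec B) = Cell0 B"

text \<open>
  \<open>PMu G \<beta> \<alpha> : G \<beta> \<odot> G \<alpha> \<Rightarrow> G (\<beta> \<odot> \<alpha>)\<close> and \<open>PEta G a : i\<^bsub>G a\<^esub> \<Rightarrow> G i\<^bsub>a\<^esub>\<close> are the coherence data.
\<close>

record ('o, 'p, 'h, 'k, 's, 't) pseudofun =
  P0 :: "'o \<Rightarrow> 'p"
  P1 :: "'h \<Rightarrow> 'k"
  P2 :: "'s \<Rightarrow> 't"
  PMu :: "'h \<Rightarrow> 'h \<Rightarrow> 't"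
  PEta :: "'o \<Rightarrow> 't"

locale pseudofunctor = B: bicategory B + B': bicategory B' +
  Loc: cat_functor "Hom B" "Hom B'" "P1 G" "P2 G"
  for B :: "('o, 'h, 's, 'y) bicat_scheme"
    and B' :: "('p, 'k, 't, 'z) bicat_scheme"
    and G :: "('o, 'p, 'h, 'k, 's, 't, 'x) pseudofun_scheme" +
  assumes P0_Cell0: "a \<in> Cell0 B \<Longrightarrow> P0 G a \<in> Cell0 B'"
    and P1_Src: "\<alpha> \<in> Cell1 B \<Longrightarrow> Src B' (P1 G \<alpha>) = P0 G (Src B \<alpha>)"
    and P1_Tgt: "\<alpha> \<in> Cell1 B \<Longrightarrow> Tgt B' (P1 G \<alpha>) = P0 G (Tgt B \<alpha>)"
    and PMu_hom: "composable1 B \<beta> \<alpha> \<Longrightarrow>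
      in_hom (Hom B') (PMu G \<beta> \<alpha>) (P1 G \<beta> \<odot>\<^bsub>B'\<^esub> P1 G \<alpha>) (P1 G (\<beta> \<odot>\<^bsub>B\<^esub> \<alpha>))"
    and PMu_invertible: "composable1 B \<beta> \<alpha> \<Longrightarrow> invertible_arrow (Hom B') (PMu G \<beta> \<alpha>)"
    and PMu_natural: "composable2 B \<psi> \<phi> \<Longrightarrow>
      PMu G (Cod (Hom B) \<psi>) (Cod (Hom B) \<phi>) \<cdot>\<^bsub>B'\<^esub> (P2 G \<psi> \<otimes>\<^bsub>B'\<^esub> P2 G \<phi>)
      = P2 G (\<psi> \<otimes>\<^bsub>B\<^esub> \<phi>) \<cdot>\<^bsub>B'\<^esub> PMu G (Dom (Hom B) \<psi>) (Dom (Hom B) \<phi>)"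
    and PEta_hom: "a \<in> Cell0 B \<Longrightarrow>
      in_hom (Hom B') (PEta G a) (Unit1 B' (P0 G a)) (P1 G (Unit1 B a))"
    and PEta_invertible: "a \<in> Cell0 B \<Longrightarrow> invertible_arrow (Hom B') (PEta G a)"
    and PMu_assoc: "composable1 B \<gamma> \<beta> \<Longrightarrow> composable1 B \<beta> \<alpha> \<Longrightarrow>
      P2 G (Assoc B \<gamma> \<beta> \<alpha>) \<cdot>\<^bsub>B'\<^esub> PMu G (\<gamma> \<odot>\<^bsub>B\<^esub> \<beta>) \<alpha> \<cdot>\<^bsub>B'\<^esub> (PMu G \<gamma> \<beta> \<otimes>\<^bsub>B'\<^esub> Id2 B' (P1 G \<alpha>))
      = PMu G \<gamma> (\<beta> \<odot>\<^bsub>B\<^esub> \<alpha>) \<cdot>\<^bsub>B'\<^esub> (Id2 B' (P1 G \<gamma>) \<otimes>\<^bsub>B'\<^esub> PMu G \<beta> \<alpha>)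
          \<cdot>\<^bsub>B'\<^esub> Assoc B' (P1 G \<gamma>) (P1 G \<beta>) (P1 G \<alpha>)"
    and PMu_LUnit: "\<alpha> \<in> Cell1 B \<Longrightarrow>
      P2 G (LUnit B \<alpha>) \<cdot>\<^bsub>B'\<^esub> PMu G (Unit1 B (Tgt B \<alpha>)) \<alpha>
          \<cdot>\<^bsub>B'\<^esub> (PEta G (Tgt B \<alpha>) \<otimes>\<^bsub>B'\<^esub> Id2 B' (P1 G \<alpha>))
      = LUnit B' (P1 G \<alpha>)"
    and PMu_RUnit: "\<alpha> \<in> Cell1 B \<Longrightarrow>
      P2 G (RUnit B \<alpha>) \<cdot>\<^bsub>B'\<^esub> PMu G \<alpha> (Unit1 B (Src B \<alpha>))
          \<cdot>\<^bsub>B'\<^esub> (Id2 B' (P1 G \<alpha>) \<otimes>\<^bsub>B'\<^esub> PEta G (Src B \<alpha>))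
      = RUnit B' (P1 G \<alpha>)"

record ('o, 'p, 'h, 'k, 's, 't, 'v, 'w) dec_pseudofun = "('o, 'p, 'h, 'k, 's, 't) pseudofun" +
  PV :: "'v \<Rightarrow> 'w"

locale decorated_pseudofunctor =
  B: decorated_bicategory B + B': decorated_bicategory B' +
  pseudofunctor B B' G + Dec: cat_functor "Dec B" "Dec B'" "P0 G" "PV G"
  for B :: "('o, 'h, 's, 'v) dec_bicat"
    and B' :: "('p, 'k, 't, 'w) dec_bicat"
    and G :: "('o, 'p, 'h, 'k, 's, 't, 'v, 'w) dec_pseudofun"

text \<open>Composite of \<open>G : B \<rightarrow> B'\<close> and \<open>K : B' \<rightarrow> B''\<close>; only the last bicategory enters the data.\<close>

definition dec_pf_comp ::
  "('q, 'l, 'u, 'x) dec_bicat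
   \<Rightarrow> ('p, 'q, 'k, 'l, 't, 'u, 'w, 'x) dec_pseudofun
   \<Rightarrow> ('o, 'p, 'h, 'k, 's, 't, 'v, 'w) dec_pseudofun
   \<Rightarrow> ('o, 'q, 'h, 'l, 's, 'u, 'v, 'x) dec_pseudofun" where
  "dec_pf_comp B'' K G =
    \<lparr>P0 = P0 K \<circ> P0 G, P1 = P1 K \<circ> P1 G, P2 = P2 K \<circ> P2 G,
     PMu = (\<lambda>\<beta> \<alpha>. P2 K (PMu G \<beta> \<alpha>) \<cdot>\<^bsub>B''\<^esub> PMu K (P1 G \<beta>) (P1 G \<alpha>)),
     PEta = (\<lambda>a. P2 K (PEta G a) \<cdot>\<^bsub>B''\<^esub> PEta K (P0 G a)),
     PV = PV K \<circ> PV G\<rparr>"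

text \<open>Equality of decorated pseudofunctors with domain \<open>B\<close>, including coherence data.\<close>

definition dec_pf_eq ::
  "('o, 'h, 's, 'v) dec_bicat
   \<Rightarrow> ('o, 'p, 'h, 'k, 's, 't, 'v, 'w) dec_pseudofun
   \<Rightarrow> ('o, 'p, 'h, 'k, 's, 't, 'v, 'w) dec_pseudofun \<Rightarrow> bool" where
  "dec_pf_eq B G G' \<longleftrightarrow>
     (\<forall>a \<in> Cell0 B. P0 G a = P0 G' a \<and> PEta G a = PEta G' a) \<and>
     (\<forall>\<alpha> \<in> Cell1 B. P1 G \<alpha> = P1 G' \<alpha>) \<and>
     (\<forall>\<phi> \<in> Cell2 B. P2 G \<phi> = P2 G' \<phi>) \<and>
     (\<forall>\<beta> \<alpha>. composable1 B \<beta> \<alpha> \<longrightarrow> PMu G \<beta> \<alpha> = PMu G' \<beta> \<alpha>) \<and>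
     (\<forall>f \<in> Arr (Dec B). PV G f = PV G' f)"


subsection \<open>Double categories\<close>

text \<open>
  \<open>Dom\<close> and \<open>Cod\<close> of the category \<open>C1\<close> are the top and bottom of a square.  The suffixes \<open>O\<close> and \<open>A\<close>
  mark the object and arrow parts of the functors \<open>s\<close>, \<open>t\<close> (left and right edge), \<open>i\<close> and \<open>*\<close>.
\<close>

record ('o, 'v, 'h, 's) dblcat =
  C0 :: "('o, 'v) cat"
  C1 :: "('h, 's) cat"
  LeftO :: "'h \<Rightarrow> 'o"
  LeftA :: "'s \<Rightarrow> 'v"
  RightO :: "'h \<Rightarrow> 'o"
  RightA :: "'s \<Rightarrow> 'v"
  HIdO :: "'o \<Rightarrow> 'h"
  HIdA :: "'v \<Rightarrow> 's"
  HCompO :: "'h \<Rightarrow> 'h \<Rightarrow> 'h"  (infixr "\<ast>\<index>" 70)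
  HCompA :: "'s \<Rightarrow> 's \<Rightarrow> 's"  (infixr "\<star>\<index>" 70)
  DAssoc :: "'h \<Rightarrow> 'h \<Rightarrow> 'h \<Rightarrow> 's"
  DLUnit :: "'h \<Rightarrow> 's"
  DRUnit :: "'h \<Rightarrow> 's"

abbreviation VCompA :: "('o, 'v, 'h, 's) dblcat \<Rightarrow> 's \<Rightarrow> 's \<Rightarrow> 's"  (infixr "\<bullet>\<index>" 65) where
  "VCompA C \<Psi> \<Phi> \<equiv> Comp (C1 C) \<Psi> \<Phi>"

definition hcompO :: "('o, 'v, 'h, 's) dblcat \<Rightarrow> 'h \<Rightarrow> 'h \<Rightarrow> bool" where
  "hcompO C \<beta> \<alpha> \<longleftrightarrow> \<beta> \<in> Obj (C1 C) \<and> \<alpha> \<in> Obj (C1 C) \<and> LeftO C \<beta> = RightO C \<alpha>"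

definition hcompA :: "('o, 'v, 'h, 's) dblcat \<Rightarrow> 's \<Rightarrow> 's \<Rightarrow> bool" where
  "hcompA C \<Psi> \<Phi> \<longleftrightarrow> \<Psi> \<in> Arr (C1 C) \<and> \<Phi> \<in> Arr (C1 C) \<and> LeftA C \<Psi> = RightA C \<Phi>"

text \<open>The fibre product \<open>C1 \<times> C1\<close> over \<open>C0\<close>.\<close>

definition hpairs_cat :: "('o, 'v, 'h, 's) dblcat \<Rightarrow> ('h \<times> 'h, 's \<times> 's) cat" where
  "hpairs_cat C = (prod_cat (C1 C) (C1 C))
     \<lparr>Obj := {(\<beta>, \<alpha>). hcompO C \<beta> \<alpha>}, Arr := {(\<Psi>, \<Phi>). hcompA C \<Psi> \<Phi>}\<rparr>"

definition globular :: "('o, 'v, 'h, 's) dblcat \<Rightarrow> 's \<Rightarrow> bool" where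
  "globular C \<Phi> \<longleftrightarrow> \<Phi> \<in> Arr (C1 C)
     \<and> LeftA C \<Phi> = Idn (C0 C) (LeftO C (Dom (C1 C) \<Phi>))
     \<and> RightA C \<Phi> = Idn (C0 C) (RightO C (Dom (C1 C) \<Phi>))"

locale double_category =
  fixes C :: "('o, 'v, 'h, 's) dblcat"
  assumes Left_functor: "cat_functor (C1 C) (C0 C) (LeftO C) (LeftA C)"
    and Right_functor: "cat_functor (C1 C) (C0 C) (RightO C) (RightA C)"
    and HId_functor: "cat_functor (C0 C) (C1 C) (HIdO C) (HIdA C)"
    and HComp_functor: "cat_functor (hpairs_cat C) (C1 C)
      (\<lambda>(\<beta>, \<alpha>). \<beta> \<ast>\<^bsub>C\<^esub> \<alpha>) (\<lambda>(\<Psi>, \<Phi>). \<Psi> \<star>\<^bsub>C\<^esub> \<Phi>)"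
    and HIdO_edges: "a \<in> Obj (C0 C) \<Longrightarrow> LeftO C (HIdO C a) = a \<and> RightO C (HIdO C a) = a"
    and HIdA_edges: "f \<in> Arr (C0 C) \<Longrightarrow> LeftA C (HIdA C f) = f \<and> RightA C (HIdA C f) = f"
    and HCompO_edges: "hcompO C \<beta> \<alpha> \<Longrightarrow>
      LeftO C (\<beta> \<ast>\<^bsub>C\<^esub> \<alpha>) = LeftO C \<alpha> \<and> RightO C (\<beta> \<ast>\<^bsub>C\<^esub> \<alpha>) = RightO C \<beta>"
    and HCompA_edges: "hcompA C \<Psi> \<Phi> \<Longrightarrow>
      LeftA C (\<Psi> \<star>\<^bsub>C\<^esub> \<Phi>) = LeftA C \<Phi> \<and> RightA C (\<Psi> \<star>\<^bsub>C\<^esub> \<Phi>) = RightA C \<Psi>"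
    and DAssoc_hom: "hcompO C \<gamma> \<beta> \<Longrightarrow> hcompO C \<beta> \<alpha> \<Longrightarrow>
      in_hom (C1 C) (DAssoc C \<gamma> \<beta> \<alpha>) ((\<gamma> \<ast>\<^bsub>C\<^esub> \<beta>) \<ast>\<^bsub>C\<^esub> \<alpha>) (\<gamma> \<ast>\<^bsub>C\<^esub> (\<beta> \<ast>\<^bsub>C\<^esub> \<alpha>))"
    and DAssoc_globular: "hcompO C \<gamma> \<beta> \<Longrightarrow> hcompO C \<beta> \<alpha> \<Longrightarrow>
      globular C (DAssoc C \<gamma> \<beta> \<alpha>) \<and> invertible_arrow (C1 C) (DAssoc C \<gamma> \<beta> \<alpha>)"
    and DAssoc_natural: "hcompA C \<Xi> \<Psi> \<Longrightarrow> hcompA C \<Psi> \<Phi> \<Longrightarrow>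
      DAssoc C (Cod (C1 C) \<Xi>) (Cod (C1 C) \<Psi>) (Cod (C1 C) \<Phi>) \<bullet>\<^bsub>C\<^esub> ((\<Xi> \<star>\<^bsub>C\<^esub> \<Psi>) \<star>\<^bsub>C\<^esub> \<Phi>)
      = (\<Xi> \<star>\<^bsub>C\<^esub> (\<Psi> \<star>\<^bsub>C\<^esub> \<Phi>)) \<bullet>\<^bsub>C\<^esub> DAssoc C (Dom (C1 C) \<Xi>) (Dom (C1 C) \<Psi>) (Dom (C1 C) \<Phi>)"
    and DLUnit_hom: "\<alpha> \<in> Obj (C1 C) \<Longrightarrow>
      in_hom (C1 C) (DLUnit C \<alpha>) (HIdO C (RightO C \<alpha>) \<ast>\<^bsub>C\<^esub> \<alpha>) \<alpha>"
    and DLUnit_globular: "\<alpha> \<in> Obj (C1 C) \<Longrightarrow>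
      globular C (DLUnit C \<alpha>) \<and> invertible_arrow (C1 C) (DLUnit C \<alpha>)"
    and DLUnit_natural: "in_hom (C1 C) \<Phi> \<alpha> \<beta> \<Longrightarrow>
      DLUnit C \<beta> \<bullet>\<^bsub>C\<^esub> (HIdA C (RightA C \<Phi>) \<star>\<^bsub>C\<^esub> \<Phi>) = \<Phi> \<bullet>\<^bsub>C\<^esub> DLUnit C \<alpha>"
    and DRUnit_hom: "\<alpha> \<in> Obj (C1 C) \<Longrightarrow>
      in_hom (C1 C) (DRUnit C \<alpha>) (\<alpha> \<ast>\<^bsub>C\<^esub> HIdO C (LeftO C \<alpha>)) \<alpha>"
    and DRUnit_globular: "\<alpha> \<in> Obj (C1 C) \<Longrightarrow>
      globular C (DRUnit C \<alpha>) \<and> invertible_arrow (C1 C) (DRUnit C \<alpha>)"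
    and DRUnit_natural: "in_hom (C1 C) \<Phi> \<alpha> \<beta> \<Longrightarrow>
      DRUnit C \<beta> \<bullet>\<^bsub>C\<^esub> (\<Phi> \<star>\<^bsub>C\<^esub> HIdA C (LeftA C \<Phi>)) = \<Phi> \<bullet>\<^bsub>C\<^esub> DRUnit C \<alpha>"
    and pentagon: "hcompO C \<delta> \<gamma> \<Longrightarrow> hcompO C \<gamma> \<beta> \<Longrightarrow> hcompO C \<beta> \<alpha> \<Longrightarrow>
      DAssoc C \<delta> \<gamma> (\<beta> \<ast>\<^bsub>C\<^esub> \<alpha>) \<bullet>\<^bsub>C\<^esub> DAssoc C (\<delta> \<ast>\<^bsub>C\<^esub> \<gamma>) \<beta> \<alpha>
      = (Idn (C1 C) \<delta> \<star>\<^bsub>C\<^esub> DAssoc C \<gamma> \<beta> \<alpha>) \<bullet>\<^bsub>C\<^esub> DAssoc C \<delta> (\<gamma> \<ast>\<^bsub>C\<^esub> \<beta>) \<alpha>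
          \<bullet>\<^bsub>C\<^esub> (DAssoc C \<delta> \<gamma> \<beta> \<star>\<^bsub>C\<^esub> Idn (C1 C) \<alpha>)"
    and triangle: "hcompO C \<beta> \<alpha> \<Longrightarrow>
      (Idn (C1 C) \<beta> \<star>\<^bsub>C\<^esub> DLUnit C \<alpha>) \<bullet>\<^bsub>C\<^esub> DAssoc C \<beta> (HIdO C (RightO C \<alpha>)) \<alpha>
      = DRUnit C \<beta> \<star>\<^bsub>C\<^esub> Idn (C1 C) \<alpha>"

record ('o, 'p, 'v, 'w, 'h, 'k, 's, 't) dblfun =
  FO :: "'o \<Rightarrow> 'p"
  FV :: "'v \<Rightarrow> 'w"
  FH :: "'h \<Rightarrow> 'k"
  FS :: "'s \<Rightarrow> 't"
  FMu :: "'h \<Rightarrow> 'h \<Rightarrow> 't"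
  FEta :: "'o \<Rightarrow> 't"

locale double_functor = C: double_category C + C': double_category C' +
  F0: cat_functor "C0 C" "C0 C'" "FO F" "FV F" + F1: cat_functor "C1 C" "C1 C'" "FH F" "FS F"
  for C :: "('o, 'v, 'h, 's) dblcat"
    and C' :: "('p, 'w, 'k, 't) dblcat"
    and F :: "('o, 'p, 'v, 'w, 'h, 'k, 's, 't) dblfun" +
  assumes FH_edges: "\<alpha> \<in> Obj (C1 C) \<Longrightarrow>
      LeftO C' (FH F \<alpha>) = FO F (LeftO C \<alpha>) \<and> RightO C' (FH F \<alpha>) = FO F (RightO C \<alpha>)"
    and FS_edges: "\<Phi> \<in> Arr (C1 C) \<Longrightarrow>
      LeftA C' (FS F \<Phi>) = FV F (LeftA C \<Phi>) \<and> RightA C' (FS F \<Phi>) = FV F (RightA C \<Phi>)"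
    and FMu_hom: "hcompO C \<beta> \<alpha> \<Longrightarrow>
      in_hom (C1 C') (FMu F \<beta> \<alpha>) (FH F \<beta> \<ast>\<^bsub>C'\<^esub> FH F \<alpha>) (FH F (\<beta> \<ast>\<^bsub>C\<^esub> \<alpha>))"
    and FMu_globular: "hcompO C \<beta> \<alpha> \<Longrightarrow>
      globular C' (FMu F \<beta> \<alpha>) \<and> invertible_arrow (C1 C') (FMu F \<beta> \<alpha>)"
    and FMu_natural: "hcompA C \<Psi> \<Phi> \<Longrightarrow>
      FMu F (Cod (C1 C) \<Psi>) (Cod (C1 C) \<Phi>) \<bullet>\<^bsub>C'\<^esub> (FS F \<Psi> \<star>\<^bsub>C'\<^esub> FS F \<Phi>)
      = FS F (\<Psi> \<star>\<^bsub>C\<^esub> \<Phi>) \<bullet>\<^bsub>C'\<^esub> FMu F (Dom (C1 C) \<Psi>) (Dom (C1 C) \<Phi>)"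
    and FEta_hom: "a \<in> Obj (C0 C) \<Longrightarrow>
      in_hom (C1 C') (FEta F a) (HIdO C' (FO F a)) (FH F (HIdO C a))"
    and FEta_globular: "a \<in> Obj (C0 C) \<Longrightarrow>
      globular C' (FEta F a) \<and> invertible_arrow (C1 C') (FEta F a)"
    and FEta_natural: "in_hom (C0 C) f a b \<Longrightarrow>
      FEta F b \<bullet>\<^bsub>C'\<^esub> HIdA C' (FV F f) = FS F (HIdA C f) \<bullet>\<^bsub>C'\<^esub> FEta F a"
    and FMu_assoc: "hcompO C \<gamma> \<beta> \<Longrightarrow> hcompO C \<beta> \<alpha> \<Longrightarrow>
      FS F (DAssoc C \<gamma> \<beta> \<alpha>) \<bullet>\<^bsub>C'\<^esub> FMu F (\<gamma> \<ast>\<^bsub>C\<^esub> \<beta>) \<alpha> \<bullet>\<^bsub>C'\<^esub> (FMu F \<gamma> \<beta> \<star>\<^bsub>C'\<^esub> Idn (C1 C') (FH F \<alpha>))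
      = FMu F \<gamma> (\<beta> \<ast>\<^bsub>C\<^esub> \<alpha>) \<bullet>\<^bsub>C'\<^esub> (Idn (C1 C') (FH F \<gamma>) \<star>\<^bsub>C'\<^esub> FMu F \<beta> \<alpha>)
          \<bullet>\<^bsub>C'\<^esub> DAssoc C' (FH F \<gamma>) (FH F \<beta>) (FH F \<alpha>)"
    and FMu_LUnit: "\<alpha> \<in> Obj (C1 C) \<Longrightarrow>
      FS F (DLUnit C \<alpha>) \<bullet>\<^bsub>C'\<^esub> FMu F (HIdO C (RightO C \<alpha>)) \<alpha>
          \<bullet>\<^bsub>C'\<^esub> (FEta F (RightO C \<alpha>) \<star>\<^bsub>C'\<^esub> Idn (C1 C') (FH F \<alpha>))
      = DLUnit C' (FH F \<alpha>)"
    and FMu_RUnit: "\<alpha> \<in> Obj (C1 C) \<Longrightarrow>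
      FS F (DRUnit C \<alpha>) \<bullet>\<^bsub>C'\<^esub> FMu F \<alpha> (HIdO C (LeftO C \<alpha>))
          \<bullet>\<^bsub>C'\<^esub> (Idn (C1 C') (FH F \<alpha>) \<star>\<^bsub>C'\<^esub> FEta F (LeftO C \<alpha>))
      = DRUnit C' (FH F \<alpha>)"

text \<open>Equality of double functors with domain \<open>C\<close>, including coherence data.\<close>

definition dblfun_eq ::
  "('o, 'v, 'h, 's) dblcat
   \<Rightarrow> ('o, 'p, 'v, 'w, 'h, 'k, 's, 't) dblfun
   \<Rightarrow> ('o, 'p, 'v, 'w, 'h, 'k, 's, 't) dblfun \<Rightarrow> bool" where
  "dblfun_eq C F F' \<longleftrightarrow>
     (\<forall>a \<in> Obj (C0 C). FO F a = FO F' a \<and> FEta F a = FEta F' a) \<and>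
     (\<forall>f \<in> Arr (C0 C). FV F f = FV F' f) \<and>
     (\<forall>\<alpha> \<in> Obj (C1 C). FH F \<alpha> = FH F' \<alpha>) \<and>
     (\<forall>\<Phi> \<in> Arr (C1 C). FS F \<Phi> = FS F' \<Phi>) \<and>
     (\<forall>\<beta> \<alpha>. hcompO C \<beta> \<alpha> \<longrightarrow> FMu F \<beta> \<alpha> = FMu F' \<beta> \<alpha>)"

definition Hstar :: "('o, 'v, 'h, 's) dblcat \<Rightarrow> ('o, 'h, 's, 'v) dec_bicat" where
  "Hstar C = \<lparr>Cell0 = Obj (C0 C), Hom = (C1 C)\<lparr>Arr := {\<Phi>. globular C \<Phi>}\<rparr>,
     Src = LeftO C, Tgt = RightO C, Unit1 = HIdO C, HComp1 = HCompO C, HComp2 = HCompA C,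
     Assoc = DAssoc C, LUnit = DLUnit C, RUnit = DRUnit C, Dec = C0 C\<rparr>"

definition Hstar_fun ::
  "('o, 'p, 'v, 'w, 'h, 'k, 's, 't) dblfun \<Rightarrow> ('o, 'p, 'h, 'k, 's, 't, 'v, 'w) dec_pseudofun" where
  "Hstar_fun F = \<lparr>P0 = FO F, P1 = FH F, P2 = FS F, PMu = FMu F, PEta = FEta F, PV = FV F\<rparr>"


subsection \<open>The free globularly generated double category\<close>

datatype ('v, 's) fsquare =
  Cell 's
| HIdSq 'v
| Vert "('v, 's) fsquare" "('v, 's) fsquare"
| Horiz "('v, 's) fsquare" "('v, 's) fsquare"

primrec top_edge :: "('o, 'h, 's, 'v) dec_bicat \<Rightarrow> ('v, 's) fsquare \<Rightarrow> 'h" where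
  "top_edge B (Cell \<phi>) = Dom (Hom B) \<phi>"
| "top_edge B (HIdSq f) = Unit1 B (Dom (Dec B) f)"
| "top_edge B (Vert \<Psi> \<Phi>) = top_edge B \<Phi>"
| "top_edge B (Horiz \<Psi> \<Phi>) = top_edge B \<Psi> \<odot>\<^bsub>B\<^esub> top_edge B \<Phi>"

primrec bottom_edge :: "('o, 'h, 's, 'v) dec_bicat \<Rightarrow> ('v, 's) fsquare \<Rightarrow> 'h" where
  "bottom_edge B (Cell \<phi>) = Cod (Hom B) \<phi>"
| "bottom_edge B (HIdSq f) = Unit1 B (Cod (Dec B) f)"
| "bottom_edge B (Vert \<Psi> \<Phi>) = bottom_edge B \<Psi>"
| "bottom_edge B (Horiz \<Psi> \<Phi>) = bottom_edge B \<Psi> \<odot>\<^bsub>B\<^esub> bottom_edge B \<Phi>"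

primrec left_edge :: "('o, 'h, 's, 'v) dec_bicat \<Rightarrow> ('v, 's) fsquare \<Rightarrow> 'v" where
  "left_edge B (Cell \<phi>) = Idn (Dec B) (Src B (Dom (Hom B) \<phi>))"
| "left_edge B (HIdSq f) = f"
| "left_edge B (Vert \<Psi> \<Phi>) = Comp (Dec B) (left_edge B \<Psi>) (left_edge B \<Phi>)"
| "left_edge B (Horiz \<Psi> \<Phi>) = left_edge B \<Phi>"

primrec right_edge :: "('o, 'h, 's, 'v) dec_bicat \<Rightarrow> ('v, 's) fsquare \<Rightarrow> 'v" where
  "right_edge B (Cell \<phi>) = Idn (Dec B) (Tgt B (Dom (Hom B) \<phi>))"
| "right_edge B (HIdSq f) = f"
| "right_edge B (Vert \<Psi> \<Phi>) = Comp (Dec B) (right_edge B \<Psi>) (right_edge B \<Phi>)"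
| "right_edge B (Horiz \<Psi> \<Phi>) = right_edge B \<Psi>"

inductive_set fsquares :: "('o, 'h, 's, 'v) dec_bicat \<Rightarrow> ('v, 's) fsquare set"
  for B :: "('o, 'h, 's, 'v) dec_bicat" where
  "\<phi> \<in> Cell2 B \<Longrightarrow> Cell \<phi> \<in> fsquares B"
| "f \<in> Arr (Dec B) \<Longrightarrow> HIdSq f \<in> fsquares B"
| "\<Psi> \<in> fsquares B \<Longrightarrow> \<Phi> \<in> fsquares B \<Longrightarrow> bottom_edge B \<Phi> = top_edge B \<Psi>
    \<Longrightarrow> Vert \<Psi> \<Phi> \<in> fsquares B"
| "\<Psi> \<in> fsquares B \<Longrightarrow> \<Phi> \<in> fsquares B \<Longrightarrow> right_edge B \<Phi> = left_edge B \<Psi>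
    \<Longrightarrow> Horiz \<Psi> \<Phi> \<in> fsquares B"

text \<open>
  The requirement that both sides of an identification be well-formed is imposed by membership in
  \<open>fsquares B\<close>.  The rule \<open>unit_cell\<close> is the identification of the two generators
  \<open>i\<^bsub>id\<^esub>\<close> and \<open>id\<^bsub>i\<^esub>\<close>.
\<close>

inductive fequiv :: "('o, 'h, 's, 'v) dec_bicat \<Rightarrow> ('v, 's) fsquare \<Rightarrow> ('v, 's) fsquare \<Rightarrow> bool"
  for B :: "('o, 'h, 's, 'v) dec_bicat" where
  refl: "\<Phi> \<in> fsquares B \<Longrightarrow> fequiv B \<Phi> \<Phi>"
| sym: "fequiv B \<Phi> \<Psi> \<Longrightarrow> fequiv B \<Psi> \<Phi>"
| trans: "fequiv B \<Phi> \<Psi> \<Longrightarrow> fequiv B \<Psi> \<Xi> \<Longrightarrow> fequiv B \<Phi> \<Xi>"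
| Vert_cong: "fequiv B \<Psi> \<Psi>' \<Longrightarrow> fequiv B \<Phi> \<Phi>' \<Longrightarrow> Vert \<Psi> \<Phi> \<in> fsquares B
    \<Longrightarrow> Vert \<Psi>' \<Phi>' \<in> fsquares B \<Longrightarrow> fequiv B (Vert \<Psi> \<Phi>) (Vert \<Psi>' \<Phi>')"
| Horiz_cong: "fequiv B \<Psi> \<Psi>' \<Longrightarrow> fequiv B \<Phi> \<Phi>' \<Longrightarrow> Horiz \<Psi> \<Phi> \<in> fsquares B
    \<Longrightarrow> Horiz \<Psi>' \<Phi>' \<in> fsquares B \<Longrightarrow> fequiv B (Horiz \<Psi> \<Phi>) (Horiz \<Psi>' \<Phi>')"
| unit_cell: "a \<in> Cell0 B \<Longrightarrow> fequiv B (HIdSq (Idn (Dec B) a)) (Cell (Id2 B (Unit1 B a)))"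
| Vert_assoc: "Vert (Vert \<Xi> \<Psi>) \<Phi> \<in> fsquares B
    \<Longrightarrow> fequiv B (Vert (Vert \<Xi> \<Psi>) \<Phi>) (Vert \<Xi> (Vert \<Psi> \<Phi>))"
| Vert_id_bottom: "\<Phi> \<in> fsquares B \<Longrightarrow> fequiv B (Vert (Cell (Id2 B (bottom_edge B \<Phi>))) \<Phi>) \<Phi>"
| Vert_id_top: "\<Phi> \<in> fsquares B \<Longrightarrow> fequiv B (Vert \<Phi> (Cell (Id2 B (top_edge B \<Phi>)))) \<Phi>"
| interchange: "Horiz (Vert \<Psi>\<^sub>2 \<Psi>\<^sub>1) (Vert \<Phi>\<^sub>2 \<Phi>\<^sub>1) \<in> fsquares B
    \<Longrightarrow> Vert (Horiz \<Psi>\<^sub>2 \<Phi>\<^sub>2) (Horiz \<Psi>\<^sub>1 \<Phi>\<^sub>1) \<in> fsquares B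
    \<Longrightarrow> fequiv B (Horiz (Vert \<Psi>\<^sub>2 \<Psi>\<^sub>1) (Vert \<Phi>\<^sub>2 \<Phi>\<^sub>1)) (Vert (Horiz \<Psi>\<^sub>2 \<Phi>\<^sub>2) (Horiz \<Psi>\<^sub>1 \<Phi>\<^sub>1))"
| Vert_cells: "in_hom (Hom B) \<phi> \<alpha> \<beta> \<Longrightarrow> in_hom (Hom B) \<psi> \<beta> \<gamma>
    \<Longrightarrow> fequiv B (Vert (Cell \<psi>) (Cell \<phi>)) (Cell (\<psi> \<cdot>\<^bsub>B\<^esub> \<phi>))"
| Vert_HIdSq: "in_hom (Dec B) f a b \<Longrightarrow> in_hom (Dec B) g b c
    \<Longrightarrow> fequiv B (Vert (HIdSq g) (HIdSq f)) (HIdSq (Comp (Dec B) g f))"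
| Horiz_cells: "composable2 B \<psi> \<phi>
    \<Longrightarrow> fequiv B (Horiz (Cell \<psi>) (Cell \<phi>)) (Cell (\<psi> \<otimes>\<^bsub>B\<^esub> \<phi>))"
| LUnit_natural: "\<Phi> \<in> fsquares B
    \<Longrightarrow> fequiv B (Vert (Cell (LUnit B (bottom_edge B \<Phi>))) (Horiz (HIdSq (right_edge B \<Phi>)) \<Phi>))
                 (Vert \<Phi> (Cell (LUnit B (top_edge B \<Phi>))))"
| RUnit_natural: "\<Phi> \<in> fsquares B
    \<Longrightarrow> fequiv B (Vert (Cell (RUnit B (bottom_edge B \<Phi>))) (Horiz \<Phi> (HIdSq (left_edge B \<Phi>))))
                 (Vert \<Phi> (Cell (RUnit B (top_edge B \<Phi>))))"
| Assoc_natural: "Horiz (Horiz \<Xi> \<Psi>) \<Phi> \<in> fsquares B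
    \<Longrightarrow> fequiv B
      (Vert (Cell (Assoc B (bottom_edge B \<Xi>) (bottom_edge B \<Psi>) (bottom_edge B \<Phi>)))
            (Horiz (Horiz \<Xi> \<Psi>) \<Phi>))
      (Vert (Horiz \<Xi> (Horiz \<Psi> \<Phi>))
            (Cell (Assoc B (top_edge B \<Xi>) (top_edge B \<Psi>) (top_edge B \<Phi>))))"

definition fclass :: "('o, 'h, 's, 'v) dec_bicat \<Rightarrow> ('v, 's) fsquare \<Rightarrow> ('v, 's) fsquare set" where
  "fclass B \<Phi> = {\<Psi>. fequiv B \<Phi> \<Psi>}"

text \<open>
  Operations on classes are induced from representatives: \<open>the_elem\<close> extracts the common value of the
  edge functions, and the unions run over equal classes.
\<close>

definition Q :: "('o, 'h, 's, 'v) dec_bicat \<Rightarrow> ('o, 'v, 'h, ('v, 's) fsquare set) dblcat" where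
  "Q B =
    \<lparr>C0 = Dec B,
     C1 = \<lparr>Obj = Cell1 B, Arr = fclass B ` fsquares B,
           Dom = (\<lambda>X. the_elem (top_edge B ` X)), Cod = (\<lambda>X. the_elem (bottom_edge B ` X)),
           Idn = (\<lambda>\<alpha>. fclass B (Cell (Id2 B \<alpha>))),
           Comp = (\<lambda>Y X. \<Union>\<Psi>\<in>Y. \<Union>\<Phi>\<in>X. fclass B (Vert \<Psi> \<Phi>))\<rparr>,
     LeftO = Src B, LeftA = (\<lambda>X. the_elem (left_edge B ` X)),
     RightO = Tgt B, RightA = (\<lambda>X. the_elem (right_edge B ` X)),
     HIdO = Unit1 B, HIdA = (\<lambda>f. fclass B (HIdSq f)),
     HCompO = HComp1 B, HCompA = (\<lambda>Y X. \<Union>\<Psi>\<in>Y. \<Union>\<Phi>\<in>X. fclass B (Horiz \<Psi> \<Phi>)),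
     DAssoc = (\<lambda>\<gamma> \<beta> \<alpha>. fclass B (Cell (Assoc B \<gamma> \<beta> \<alpha>))),
     DLUnit = (\<lambda>\<alpha>. fclass B (Cell (LUnit B \<alpha>))),
     DRUnit = (\<lambda>\<alpha>. fclass B (Cell (RUnit B \<alpha>)))\<rparr>"

text \<open>The inclusion of \<open>B\<close> into \<open>Hstar (Q B)\<close>; it is strict, so its coherence data are identities.\<close>

definition incl ::
  "('o, 'h, 's, 'v) dec_bicat
   \<Rightarrow> ('o, 'o, 'h, 'h, 's, ('v, 's) fsquare set, 'v, 'v) dec_pseudofun" where
  "incl B = \<lparr>P0 = id, P1 = id, P2 = (\<lambda>\<phi>. fclass B (Cell \<phi>)),
     PMu = (\<lambda>\<beta> \<alpha>. Idn (C1 (Q B)) (\<beta> \<odot>\<^bsub>B\<^esub> \<alpha>)), PEta = (\<lambda>a. Idn (C1 (Q B)) (Unit1 B a)), PV = id\<rparr>"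


subsection \<open>The free double functor\<close>

text \<open>
  Squares over \<open>G i\<^bsub>a\<^esub>\<close> or \<open>G (\<beta> \<odot> \<alpha>)\<close> are obtained from squares over \<open>i\<^bsub>G a\<^esub>\<close> or \<open>G \<beta> \<odot> G \<alpha>\<close> by
  conjugating with the coherence cells of \<open>G\<close>; this is what extending \<open>i\<^bsub>f\<^esub> \<mapsto> i\<^bsub>G* f\<^esub>\<close> compatibly
  with \<open>*\<close> means when \<open>G\<close> is not strict.
\<close>

primrec Q_ext ::
  "('o, 'h, 's, 'v) dec_bicat \<Rightarrow> ('p, 'k, 't, 'w) dec_bicat
   \<Rightarrow> ('o, 'p, 'h, 'k, 's, 't, 'v, 'w) dec_pseudofun \<Rightarrow> ('v, 's) fsquare \<Rightarrow> ('w, 't) fsquare" where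
  "Q_ext B B' G (Cell \<phi>) = Cell (P2 G \<phi>)"
| "Q_ext B B' G (HIdSq f) =
     Vert (Cell (PEta G (Cod (Dec B) f)))
       (Vert (HIdSq (PV G f)) (Cell (inverse_arrow (Hom B') (PEta G (Dom (Dec B) f)))))"
| "Q_ext B B' G (Vert \<Psi> \<Phi>) = Vert (Q_ext B B' G \<Psi>) (Q_ext B B' G \<Phi>)"
| "Q_ext B B' G (Horiz \<Psi> \<Phi>) =
     Vert (Cell (PMu G (bottom_edge B \<Psi>) (bottom_edge B \<Phi>)))
       (Vert (Horiz (Q_ext B B' G \<Psi>) (Q_ext B B' G \<Phi>))
         (Cell (inverse_arrow (Hom B') (PMu G (top_edge B \<Psi>) (top_edge B \<Phi>)))))"

definition Q_fun ::
  "('o, 'h, 's, 'v) dec_bicat \<Rightarrow> ('p, 'k, 't, 'w) dec_bicat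
   \<Rightarrow> ('o, 'p, 'h, 'k, 's, 't, 'v, 'w) dec_pseudofun
   \<Rightarrow> ('o, 'p, 'v, 'w, 'h, 'k, ('v, 's) fsquare set, ('w, 't) fsquare set) dblfun" where
  "Q_fun B B' G =
    \<lparr>FO = P0 G, FV = PV G, FH = P1 G,
     FS = (\<lambda>X. \<Union>\<Phi>\<in>X. fclass B' (Q_ext B B' G \<Phi>)),
     FMu = (\<lambda>\<beta> \<alpha>. fclass B' (Cell (PMu G \<beta> \<alpha>))),
     FEta = (\<lambda>a. fclass B' (Cell (PEta G a)))\<rparr>"

text \<open>
  \<open>restricts_to B B' F G\<close> is the equation \<open>Hstar_fun F \<circ> incl B = incl B' \<circ> G\<close> of decorated
  pseudofunctors from \<open>B\<close> to \<open>Hstar (Q B')\<close>.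
\<close>

definition restricts_to ::
  "('o, 'h, 's, 'v) dec_bicat \<Rightarrow> ('p, 'k, 't, 'w) dec_bicat
   \<Rightarrow> ('o, 'p, 'v, 'w, 'h, 'k, ('v, 's) fsquare set, ('w, 't) fsquare set) dblfun
   \<Rightarrow> ('o, 'p, 'h, 'k, 's, 't, 'v, 'w) dec_pseudofun \<Rightarrow> bool" where
  "restricts_to B B' F G \<longleftrightarrow>
     dec_pf_eq B (dec_pf_comp (Hstar (Q B')) (Hstar_fun F) (incl B))
                 (dec_pf_comp (Hstar (Q B')) (incl B') G)"

end

theory Submission
  imports Defs
begin

text \<open>
  Once the relations are known to preserve edges, each axiom of a double category holds in \<open>Q B\<close>
  because it is a defining relation or is inherited from \<open>B\<close>.  Write \<open>E\<close> for the square of \<open>Q B'\<close>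
  attached by \<open>Q_ext\<close> to an expression.  On the composites \<open>Horiz \<Psi> \<Phi>\<close> and on the squares \<open>HIdSq f\<close>,
  \<open>E\<close> is characterised by
  \<open>E (Horiz \<Psi> \<Phi>) \<bullet> \<mu> = \<mu> \<bullet> (E \<Psi> \<star> E \<Phi>)\<close> and \<open>E (HIdSq f) \<bullet> \<eta> = \<eta> \<bullet> i\<^bsub>G f\<^esub>\<close>, because the coherence
  cells \<open>\<mu>\<close>, \<open>\<eta>\<close> of \<open>G\<close> are invertible.  Cancelling them, every relation of \<open>Q B\<close> follows from
  the corresponding axiom of \<open>Q B'\<close> and the coherence axioms of \<open>G\<close>, so \<open>E\<close> descends to classes.
  Any double functor extending \<open>G\<close> satisfies the same two equations by naturality of its coherence
  data, hence agrees with \<open>E\<close> on all expressions.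
\<close>

subsection \<open>Categories and bicategories\<close>

context category
begin

lemma Idn_simps [simp]:
  assumes "a \<in> Obj C"
  shows "Idn C a \<in> Arr C" "Dom C (Idn C a) = a" "Cod C (Idn C a) = a"
  using Idn_hom [OF assms] by (simp_all add: in_hom_def)

text \<open>Memberships and boundary equations, in place of \<open>in_hom\<close> with free objects,
  are premises that the simplifier can discharge; functors and horizontal composites are treated in
  the same form below.\<close>

lemma Comp_simps [simp]:
  assumes "f \<in> Arr C" "g \<in> Arr C" "Dom C g = Cod C f"
  shows "Comp C g f \<in> Arr C" "Dom C (Comp C g f) = Dom C f" "Cod C (Comp C g f) = Cod C g"
  using Comp_hom [of f "Dom C f" "Cod C f" g "Cod C g"] assms by (simp_all add: in_hom_def)

lemma Comp_Idn [simp]: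
  assumes "f \<in> Arr C"
  shows "Cod C f = a \<Longrightarrow> Comp C (Idn C a) f = f" "Dom C f = a \<Longrightarrow> Comp C f (Idn C a) = f"
  using assms Idn_left Idn_right by blast+

lemma assoc:
  assumes "f \<in> Arr C" "g \<in> Arr C" "h \<in> Arr C" "Dom C g = Cod C f" "Dom C h = Cod C g"
  shows "Comp C (Comp C h g) f = Comp C h (Comp C g f)"
  using Comp_assoc assms by (simp add: in_hom_def)

lemma inverse_arrow_unique:
  assumes "inverse_arrows C f g" "inverse_arrows C f h"
  shows "g = h"
proof -
  have "g = Comp C g (Comp C f h)"
    using assms by (simp add: inverse_arrows_def in_hom_def)
  also have "\<dots> = Comp C (Comp C g f) h"
    using assms by (intro assoc [symmetric]) (simp_all add: inverse_arrows_def in_hom_def)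
  also have "\<dots> = h"
    using assms by (simp add: inverse_arrows_def in_hom_def)
  finally show ?thesis .
qed

lemma inverse_arrow:
  assumes "invertible_arrow C f"
  shows "inverse_arrows C f (inverse_arrow C f)"
  using assms inverse_arrow_unique unfolding invertible_arrow_def inverse_arrow_def
  by (metis theI')

lemma inverse_arrow_simps:
  assumes "invertible_arrow C f"
  shows "inverse_arrow C f \<in> Arr C" "Dom C (inverse_arrow C f) = Cod C f"
    "Cod C (inverse_arrow C f) = Dom C f"
    "Comp C (inverse_arrow C f) f = Idn C (Dom C f)"
    "Comp C f (inverse_arrow C f) = Idn C (Cod C f)"
  using inverse_arrow [OF assms] by (simp_all add: inverse_arrows_def in_hom_def)

lemma Idn_invertible: "a \<in> Obj C \<Longrightarrow> invertible_arrow C (Idn C a)"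
  unfolding invertible_arrow_def inverse_arrows_def in_hom_def
  by (intro exI [of _ "Idn C a"]) simp

text \<open>Both sides are composed on the right with the inverse of \<open>f\<close>. Coherence
  cells are cancelled in this way when two squares are compared.\<close>

lemma invertible_epi:
  assumes "invertible_arrow C f" "f \<in> Arr C" "g \<in> Arr C" "h \<in> Arr C"
    "Dom C g = Cod C f" "Dom C h = Cod C f" "Comp C g f = Comp C h f"
  shows "g = h"
proof -
  note inv = inverse_arrow_simps [OF assms(1)]
  have "g = Comp C (Comp C g f) (inverse_arrow C f)"
    using assms(1-6) inv by (simp add: assoc)
  also have "\<dots> = Comp C (Comp C h f) (inverse_arrow C f)"
    by (simp add: assms)
  also have "\<dots> = h"
    using assms(1-6) inv by (simp add: assoc)
  finally show ?thesis .
qed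

end

lemma cat_functor_simps:
  assumes "cat_functor C D Fo Fa" "f \<in> Arr C"
  shows "Fa f \<in> Arr D" "Dom D (Fa f) = Fo (Dom C f)" "Cod D (Fa f) = Fo (Cod C f)"
  using cat_functor.map_hom [OF assms(1), of f "Dom C f" "Cod C f"] assms(2)
  by (simp_all add: in_hom_def)

lemma cat_functor_Comp:
  assumes "cat_functor C D Fo Fa" "f \<in> Arr C" "g \<in> Arr C" "Dom C g = Cod C f"
  shows "Fa (Comp C g f) = Comp D (Fa g) (Fa f)"
  using cat_functor.map_Comp [OF assms(1)] assms by (simp add: in_hom_def)

section \<open>Horizontal composition in a bicategory\<close>

context bicategory
begin

sublocale Hom: category "Hom B"
  by (rule Hom_category)

lemma Unit1_simps [simp]:
  assumes "a \<in> Cell0 B"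
  shows "Unit1 B a \<in> Cell1 B" "Src B (Unit1 B a) = a" "Tgt B (Unit1 B a) = a"
  using Unit1_Cell1 [OF assms] by simp_all

lemma Cod_edges [simp]:
  assumes "\<phi> \<in> Cell2 B"
  shows "Src B (Cod (Hom B) \<phi>) = Src B (Dom (Hom B) \<phi>)"
    "Tgt B (Cod (Hom B) \<phi>) = Tgt B (Dom (Hom B) \<phi>)"
  using parallel [OF assms] by simp_all

declare Src_Cell0 [simp] Tgt_Cell0 [simp] Hom.Dom_Obj [simp] Hom.Cod_Obj [simp]

text \<open>Horizontal composition is a functor for each triple of 0-cells; the triple is read off
  the boundary of the arguments, here and for 2-cells below.\<close>

lemma HComp1_simps [simp]:
  assumes "\<beta> \<in> Cell1 B" "\<alpha> \<in> Cell1 B" "Src B \<beta> = Tgt B \<alpha>"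
  shows "\<beta> \<odot>\<^bsub>B\<^esub> \<alpha> \<in> Cell1 B" "Src B (\<beta> \<odot>\<^bsub>B\<^esub> \<alpha>) = Src B \<alpha>" "Tgt B (\<beta> \<odot>\<^bsub>B\<^esub> \<alpha>) = Tgt B \<beta>"
  using cat_functor.map_Obj [OF HComp_functor [of "Src B \<alpha>" "Tgt B \<alpha>" "Tgt B \<beta>"], of "(\<beta>, \<alpha>)"] assms
  by (simp_all add: prod_cat_def hom_cat_def)

lemma HComp2_simps [simp]:
  assumes "\<psi> \<in> Cell2 B" "\<phi> \<in> Cell2 B" "Src B (Dom (Hom B) \<psi>) = Tgt B (Dom (Hom B) \<phi>)"
  shows "\<psi> \<otimes>\<^bsub>B\<^esub> \<phi> \<in> Cell2 B"
    "Dom (Hom B) (\<psi> \<otimes>\<^bsub>B\<^esub> \<phi>) = Dom (Hom B) \<psi> \<odot>\<^bsub>B\<^esub> Dom (Hom B) \<phi>"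
    "Cod (Hom B) (\<psi> \<otimes>\<^bsub>B\<^esub> \<phi>) = Cod (Hom B) \<psi> \<odot>\<^bsub>B\<^esub> Cod (Hom B) \<phi>"
  using cat_functor_simps [OF HComp_functor [of "Src B (Dom (Hom B) \<phi>)" "Tgt B (Dom (Hom B) \<phi>)"
      "Tgt B (Dom (Hom B) \<psi>)"], of "(\<psi>, \<phi>)"] assms
  by (simp_all add: prod_cat_def hom_cat_def)

lemma HComp2_Idn:
  assumes "\<beta> \<in> Cell1 B" "\<alpha> \<in> Cell1 B" "Src B \<beta> = Tgt B \<alpha>"
  shows "Id2 B \<beta> \<otimes>\<^bsub>B\<^esub> Id2 B \<alpha> = Id2 B (\<beta> \<odot>\<^bsub>B\<^esub> \<alpha>)"
  using cat_functor.map_Idn [OF HComp_functor [of "Src B \<alpha>" "Tgt B \<alpha>" "Tgt B \<beta>"], of "(\<beta>, \<alpha>)"] assms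
  by (simp add: prod_cat_def hom_cat_def)

lemma HComp2_interchange:
  assumes "\<psi> \<in> Cell2 B" "\<psi>' \<in> Cell2 B" "Dom (Hom B) \<psi>' = Cod (Hom B) \<psi>"
    and "\<phi> \<in> Cell2 B" "\<phi>' \<in> Cell2 B" "Dom (Hom B) \<phi>' = Cod (Hom B) \<phi>"
    and "Src B (Dom (Hom B) \<psi>) = Tgt B (Dom (Hom B) \<phi>)"
  shows "(\<psi>' \<cdot>\<^bsub>B\<^esub> \<psi>) \<otimes>\<^bsub>B\<^esub> (\<phi>' \<cdot>\<^bsub>B\<^esub> \<phi>) = (\<psi>' \<otimes>\<^bsub>B\<^esub> \<phi>') \<cdot>\<^bsub>B\<^esub> (\<psi> \<otimes>\<^bsub>B\<^esub> \<phi>)"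
  using cat_functor_Comp [OF HComp_functor [of "Src B (Dom (Hom B) \<phi>)" "Tgt B (Dom (Hom B) \<phi>)"
      "Tgt B (Dom (Hom B) \<psi>)"], of "(\<psi>, \<phi>)" "(\<psi>', \<phi>')"] assms
  by (simp add: prod_cat_def hom_cat_def)

text \<open>By interchange and preservation of identities, the horizontal composite of the inverses
  is an inverse. It is needed for whiskered coherence cells, which are cancelled in the unitor and
  associator relations.\<close>

lemma HComp2_invertible:
  assumes "invertible_arrow (Hom B) \<psi>" "invertible_arrow (Hom B) \<phi>"
    and "Src B (Dom (Hom B) \<psi>) = Tgt B (Dom (Hom B) \<phi>)"
  shows "invertible_arrow (Hom B) (\<psi> \<otimes>\<^bsub>B\<^esub> \<phi>)"
proof -
  obtain \<psi>' \<phi>' where "inverse_arrows (Hom B) \<psi> \<psi>'" "inverse_arrows (Hom B) \<phi> \<phi>'"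
    using assms by (auto simp: invertible_arrow_def)
  \<comment> \<open>The inverses start at the codomains, so these have to be composable as
    well.\<close>
  moreover from this have "Src B (Cod (Hom B) \<psi>) = Tgt B (Cod (Hom B) \<phi>)"
    using assms(3) by (auto simp: inverse_arrows_def in_hom_def)
  ultimately have "inverse_arrows (Hom B) (\<psi> \<otimes>\<^bsub>B\<^esub> \<phi>) (\<psi>' \<otimes>\<^bsub>B\<^esub> \<phi>')"
    using assms(3) unfolding inverse_arrows_def in_hom_def
    by (auto simp: HComp2_Idn simp flip: HComp2_interchange)
  then show ?thesis by (auto simp: invertible_arrow_def)
qed

lemma Assoc_simps [simp]:
  assumes "\<gamma> \<in> Cell1 B" "\<beta> \<in> Cell1 B" "\<alpha> \<in> Cell1 B" "Src B \<gamma> = Tgt B \<beta>" "Src B \<beta> = Tgt B \<alpha>"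
  shows "Assoc B \<gamma> \<beta> \<alpha> \<in> Cell2 B" "Dom (Hom B) (Assoc B \<gamma> \<beta> \<alpha>) = (\<gamma> \<odot>\<^bsub>B\<^esub> \<beta>) \<odot>\<^bsub>B\<^esub> \<alpha>"
    "Cod (Hom B) (Assoc B \<gamma> \<beta> \<alpha>) = \<gamma> \<odot>\<^bsub>B\<^esub> (\<beta> \<odot>\<^bsub>B\<^esub> \<alpha>)"
  using Assoc_hom [of \<gamma> \<beta> \<alpha>] assms by (simp_all add: in_hom_def composable1_def)

lemma Unit_simps [simp]:
  assumes "\<alpha> \<in> Cell1 B"
  shows "LUnit B \<alpha> \<in> Cell2 B" "Dom (Hom B) (LUnit B \<alpha>) = Unit1 B (Tgt B \<alpha>) \<odot>\<^bsub>B\<^esub> \<alpha>"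
    "Cod (Hom B) (LUnit B \<alpha>) = \<alpha>"
    "RUnit B \<alpha> \<in> Cell2 B" "Dom (Hom B) (RUnit B \<alpha>) = \<alpha> \<odot>\<^bsub>B\<^esub> Unit1 B (Src B \<alpha>)"
    "Cod (Hom B) (RUnit B \<alpha>) = \<alpha>"
  using LUnit_hom [OF assms] RUnit_hom [OF assms] by (simp_all add: in_hom_def)

end

subsection \<open>Edges of formal squares\<close>

lemma fsquares_simps [simp]:
  "Cell \<phi> \<in> fsquares B \<longleftrightarrow> \<phi> \<in> Cell2 B"
  "HIdSq f \<in> fsquares B \<longleftrightarrow> f \<in> Arr (Dec B)"
  "Vert \<Psi> \<Phi> \<in> fsquares B \<longleftrightarrow>
     \<Psi> \<in> fsquares B \<and> \<Phi> \<in> fsquares B \<and> bottom_edge B \<Phi> = top_edge B \<Psi>"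
  "Horiz \<Psi> \<Phi> \<in> fsquares B \<longleftrightarrow>
     \<Psi> \<in> fsquares B \<and> \<Phi> \<in> fsquares B \<and> right_edge B \<Phi> = left_edge B \<Psi>"
  by (auto intro: fsquares.intros elim: fsquares.cases)

context decorated_bicategory
begin

text \<open>\<open>Obj (Dec B)\<close> rewrites to \<open>Cell0 B\<close>, so the rules for the
  decoration are stored in terms of \<open>Cell0 B\<close>.\<close>

declare Dec_Obj [simp] Dec.Dom_Obj [simplified, simp] Dec.Cod_Obj [simplified, simp]
lemmas Dec_Idn_simps [simp] = Dec.Idn_simps [simplified]

text \<open>Induction on formation. In the \<open>Horiz\<close> case the domain and codomain of the
  shared vertical edge make the tops and the bottoms composable 1-cells.\<close>

lemma fsquares_edges:
  assumes "\<Phi> \<in> fsquares B"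
  shows "top_edge B \<Phi> \<in> Cell1 B \<and> bottom_edge B \<Phi> \<in> Cell1 B
    \<and> in_hom (Dec B) (left_edge B \<Phi>) (Src B (top_edge B \<Phi>)) (Src B (bottom_edge B \<Phi>))
    \<and> in_hom (Dec B) (right_edge B \<Phi>) (Tgt B (top_edge B \<Phi>)) (Tgt B (bottom_edge B \<Phi>))"
  using assms by induction (auto simp: in_hom_def)

lemma fsquares_edges_simps [simp]:
  assumes "\<Phi> \<in> fsquares B"
  shows "top_edge B \<Phi> \<in> Cell1 B" "bottom_edge B \<Phi> \<in> Cell1 B"
    "left_edge B \<Phi> \<in> Arr (Dec B)" "Dom (Dec B) (left_edge B \<Phi>) = Src B (top_edge B \<Phi>)"
    "Cod (Dec B) (left_edge B \<Phi>) = Src B (bottom_edge B \<Phi>)"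
    "right_edge B \<Phi> \<in> Arr (Dec B)" "Dom (Dec B) (right_edge B \<Phi>) = Tgt B (top_edge B \<Phi>)"
    "Cod (Dec B) (right_edge B \<Phi>) = Tgt B (bottom_edge B \<Phi>)"
  using fsquares_edges [OF assms] by (simp_all add: in_hom_def)

lemma fsquares_matching:
  assumes "\<Phi> \<in> fsquares B" "\<Psi> \<in> fsquares B" "right_edge B \<Phi> = left_edge B \<Psi>"
  shows "Src B (top_edge B \<Psi>) = Tgt B (top_edge B \<Phi>)"
    "Src B (bottom_edge B \<Psi>) = Tgt B (bottom_edge B \<Phi>)"
  using assms fsquares_edges_simps by metis+

text \<open>Induction over the relation. The edges, and with them the well-formedness of composites,
  thereby become properties of classes.\<close>

lemma fequiv_edges:
  assumes "fequiv B \<Phi> \<Psi>"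
  shows "\<Phi> \<in> fsquares B \<and> \<Psi> \<in> fsquares B
    \<and> top_edge B \<Phi> = top_edge B \<Psi> \<and> bottom_edge B \<Phi> = bottom_edge B \<Psi>
    \<and> left_edge B \<Phi> = left_edge B \<Psi> \<and> right_edge B \<Phi> = right_edge B \<Psi>"
  using assms
proof induction
  case (Assoc_natural \<Xi> \<Psi> \<Phi>)
  then have w: "\<Xi> \<in> fsquares B" "\<Psi> \<in> fsquares B" "\<Phi> \<in> fsquares B"
    "right_edge B \<Psi> = left_edge B \<Xi>" "right_edge B \<Phi> = left_edge B \<Psi>"
    by auto
  then show ?case
    \<comment> \<open>Composability of the three tops and of the three bottoms makes both
      associators 2-cells with the expected boundary.\<close>
    using fsquares_matching [of \<Psi> \<Xi>] fsquares_matching [of \<Phi> \<Psi>] by simp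
qed (auto simp: in_hom_def composable1_def composable2_def Dec.assoc)

end

subsection \<open>Double categories\<close>

lemma hpairs_cat_simps [simp]:
  "Obj (hpairs_cat C) = {(\<beta>, \<alpha>). hcompO C \<beta> \<alpha>}" "Arr (hpairs_cat C) = {(\<Psi>, \<Phi>). hcompA C \<Psi> \<Phi>}"
  "Dom (hpairs_cat C) = map_prod (Dom (C1 C)) (Dom (C1 C))"
  "Cod (hpairs_cat C) = map_prod (Cod (C1 C)) (Cod (C1 C))"
  "Idn (hpairs_cat C) = map_prod (Idn (C1 C)) (Idn (C1 C))"
  "Comp (hpairs_cat C) = (\<lambda>(\<Psi>, \<Psi>') (\<Phi>, \<Phi>'). (\<Psi> \<bullet>\<^bsub>C\<^esub> \<Phi>, \<Psi>' \<bullet>\<^bsub>C\<^esub> \<Phi>'))"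
  by (simp_all add: hpairs_cat_def prod_cat_def)

text \<open>Both edge maps are functors, so identities and vertical composites of matching pairs
  match again. The hypotheses stop at the two edge functors because the lemma is applied to
  \<open>Q B\<close> while its horizontal composition is being shown to be a functor.\<close>

lemma hpairs_category:
  assumes left: "cat_functor (C1 C) (C0 C) (LeftO C) (LeftA C)"
    and right: "cat_functor (C1 C) (C0 C) (RightO C) (RightA C)"
  shows "category (hpairs_cat C)"
proof -
  interpret L: cat_functor "C1 C" "C0 C" "LeftO C" "LeftA C" by (rule left)
  interpret R: cat_functor "C1 C" "C0 C" "RightO C" "RightA C" by (rule right)
  note L = cat_functor_simps [OF left] and R = cat_functor_simps [OF right]
  note C = cat_functor_Comp [OF left] cat_functor_Comp [OF right]
  show ?thesis
  proof
    fix f assume "f \<in> Arr (hpairs_cat C)"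
    then show "Dom (hpairs_cat C) f \<in> Obj (hpairs_cat C)" "Cod (hpairs_cat C) f \<in> Obj (hpairs_cat C)"
      "Comp (hpairs_cat C) (Idn (hpairs_cat C) (Cod (hpairs_cat C) f)) f = f"
      "Comp (hpairs_cat C) f (Idn (hpairs_cat C) (Dom (hpairs_cat C) f)) = f"
      by (auto simp: hcompO_def hcompA_def L.S.Dom_Obj L.S.Cod_Obj simp flip: L(2,3) R(2,3))
  next
    fix a assume "a \<in> Obj (hpairs_cat C)"
    then show "in_hom (hpairs_cat C) (Idn (hpairs_cat C) a) a a"
      by (auto simp: in_hom_def hcompO_def hcompA_def L.map_Idn R.map_Idn)
  next
    fix f g a b c assume "in_hom (hpairs_cat C) f a b" "in_hom (hpairs_cat C) g b c"
    then show "in_hom (hpairs_cat C) (Comp (hpairs_cat C) g f) a c"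
      by (auto simp: in_hom_def hcompA_def C)
  next
    fix f g h a b c d
    assume "in_hom (hpairs_cat C) f a b" "in_hom (hpairs_cat C) g b c" "in_hom (hpairs_cat C) h c d"
    then show "Comp (hpairs_cat C) (Comp (hpairs_cat C) h g) f
        = Comp (hpairs_cat C) h (Comp (hpairs_cat C) g f)"
      by (auto simp: in_hom_def hcompA_def L.S.assoc)
  qed
qed

context double_category
begin

sublocale C0: category "C0 C"
  using Left_functor by (rule cat_functor.axioms)

sublocale C1: category "C1 C"
  using Left_functor by (rule cat_functor.axioms)

declare C0.Dom_Obj [simp] C0.Cod_Obj [simp] C1.Dom_Obj [simp] C1.Cod_Obj [simp]
lemmas Left_simps [simp] = cat_functor.map_Obj [OF Left_functor] cat_functor_simps [OF Left_functor]
  cat_functor.map_Idn [OF Left_functor] cat_functor_Comp [OF Left_functor]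
lemmas Right_simps [simp] = cat_functor.map_Obj [OF Right_functor] cat_functor_simps [OF Right_functor]
  cat_functor.map_Idn [OF Right_functor] cat_functor_Comp [OF Right_functor]
lemmas HId_simps [simp] = cat_functor.map_Obj [OF HId_functor] cat_functor_simps [OF HId_functor]
  HIdO_edges [THEN conjunct1] HIdO_edges [THEN conjunct2]
  HIdA_edges [THEN conjunct1] HIdA_edges [THEN conjunct2]

lemma HCompO_simps [simp]:
  assumes "\<beta> \<in> Obj (C1 C)" "\<alpha> \<in> Obj (C1 C)" "LeftO C \<beta> = RightO C \<alpha>"
  shows "\<beta> \<ast>\<^bsub>C\<^esub> \<alpha> \<in> Obj (C1 C)"
    "LeftO C (\<beta> \<ast>\<^bsub>C\<^esub> \<alpha>) = LeftO C \<alpha>" "RightO C (\<beta> \<ast>\<^bsub>C\<^esub> \<alpha>) = RightO C \<beta>"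
  using cat_functor.map_Obj [OF HComp_functor, of "(\<beta>, \<alpha>)"] HCompO_edges [of \<beta> \<alpha>] assms
  by (simp_all add: hcompO_def)

lemma HCompA_simps [simp]:
  assumes "\<Psi> \<in> Arr (C1 C)" "\<Phi> \<in> Arr (C1 C)" "LeftA C \<Psi> = RightA C \<Phi>"
  shows "\<Psi> \<star>\<^bsub>C\<^esub> \<Phi> \<in> Arr (C1 C)"
    "Dom (C1 C) (\<Psi> \<star>\<^bsub>C\<^esub> \<Phi>) = Dom (C1 C) \<Psi> \<ast>\<^bsub>C\<^esub> Dom (C1 C) \<Phi>"
    "Cod (C1 C) (\<Psi> \<star>\<^bsub>C\<^esub> \<Phi>) = Cod (C1 C) \<Psi> \<ast>\<^bsub>C\<^esub> Cod (C1 C) \<Phi>"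
    "LeftA C (\<Psi> \<star>\<^bsub>C\<^esub> \<Phi>) = LeftA C \<Phi>" "RightA C (\<Psi> \<star>\<^bsub>C\<^esub> \<Phi>) = RightA C \<Psi>"
  using cat_functor_simps [OF HComp_functor, of "(\<Psi>, \<Phi>)"] HCompA_edges [of \<Psi> \<Phi>] assms
  by (simp_all add: hcompA_def)

lemma interchange:
  assumes "\<Psi> \<in> Arr (C1 C)" "\<Psi>' \<in> Arr (C1 C)" "Dom (C1 C) \<Psi>' = Cod (C1 C) \<Psi>"
    and "\<Phi> \<in> Arr (C1 C)" "\<Phi>' \<in> Arr (C1 C)" "Dom (C1 C) \<Phi>' = Cod (C1 C) \<Phi>"
    and "LeftA C \<Psi> = RightA C \<Phi>" "LeftA C \<Psi>' = RightA C \<Phi>'"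
  shows "(\<Psi>' \<star>\<^bsub>C\<^esub> \<Phi>') \<bullet>\<^bsub>C\<^esub> (\<Psi> \<star>\<^bsub>C\<^esub> \<Phi>) = (\<Psi>' \<bullet>\<^bsub>C\<^esub> \<Psi>) \<star>\<^bsub>C\<^esub> (\<Phi>' \<bullet>\<^bsub>C\<^esub> \<Phi>)"
  using cat_functor_Comp [OF HComp_functor, of "(\<Psi>, \<Phi>)" "(\<Psi>', \<Phi>')"] assms by (simp add: hcompA_def)

end

subsection \<open>The double category of classes\<close>

lemma Q_simps [simp]:
  "C0 (Q B) = Dec B" "Obj (C1 (Q B)) = Cell1 B" "Idn (C1 (Q B)) \<alpha> = fclass B (Cell (Id2 B \<alpha>))"
  "LeftO (Q B) = Src B" "RightO (Q B) = Tgt B" "HIdO (Q B) = Unit1 B"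
  "HIdA (Q B) f = fclass B (HIdSq f)" "HCompO (Q B) = HComp1 B"
  "DAssoc (Q B) \<gamma> \<beta> \<alpha> = fclass B (Cell (Assoc B \<gamma> \<beta> \<alpha>))"
  "DLUnit (Q B) \<alpha> = fclass B (Cell (LUnit B \<alpha>))" "DRUnit (Q B) \<alpha> = fclass B (Cell (RUnit B \<alpha>))"
  by (simp_all add: Q_def)

lemma Q_Arr: "Arr (C1 (Q B)) = fclass B ` fsquares B"
  by (simp add: Q_def)

context decorated_bicategory
begin

section \<open>Operations on classes of formal squares\<close>

lemma fclass_eqI: "fequiv B \<Phi> \<Psi> \<Longrightarrow> fclass B \<Phi> = fclass B \<Psi>"
  unfolding fclass_def by (auto intro: fequiv.sym fequiv.trans)

text \<open>A union over a nonempty family of equal sets is their common value; this evaluates the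
  operations of \<open>Q\<close> at any chosen representative.\<close>

lemma fclass_UN:
  assumes "\<Phi> \<in> fsquares B" "\<And>\<Psi>. fequiv B \<Phi> \<Psi> \<Longrightarrow> F \<Psi> = F \<Phi>"
  shows "(\<Union>\<Psi>\<in>fclass B \<Phi>. F \<Psi>) = F \<Phi>"
proof (rule SUP_eq_const)
  show "fclass B \<Phi> \<noteq> {}"
    using fequiv.refl [OF assms(1)] unfolding fclass_def by blast
qed (use assms(2) in \<open>simp add: fclass_def\<close>)

lemma fclass_UN2:
  assumes "\<Psi> \<in> fsquares B" "\<Phi> \<in> fsquares B"
    and "\<And>\<Psi>' \<Phi>'. fequiv B \<Psi> \<Psi>' \<Longrightarrow> fequiv B \<Phi> \<Phi>' \<Longrightarrow> F \<Psi>' \<Phi>' = F \<Psi> \<Phi>"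
  shows "(\<Union>\<Psi>'\<in>fclass B \<Psi>. \<Union>\<Phi>'\<in>fclass B \<Phi>. F \<Psi>' \<Phi>') = F \<Psi> \<Phi>"
proof -
  have "(\<Union>\<Phi>'\<in>fclass B \<Phi>. F \<Psi>' \<Phi>') = F \<Psi> \<Phi>" if "fequiv B \<Psi> \<Psi>'" for \<Psi>'
    using fclass_UN [of \<Phi> "F \<Psi>'"] assms that fequiv.refl by metis
  then show ?thesis
    using fclass_UN [of \<Psi> "\<lambda>\<Psi>'. \<Union>\<Phi>'\<in>fclass B \<Phi>. F \<Psi>' \<Phi>'"] assms fequiv.refl by metis
qed

lemma the_elem_fclass:
  assumes "\<Phi> \<in> fsquares B" "\<And>\<Psi>. fequiv B \<Phi> \<Psi> \<Longrightarrow> e \<Psi> = e \<Phi>"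
  shows "the_elem (e ` fclass B \<Phi>) = e \<Phi>"
proof -
  have "e ` fclass B \<Phi> = {e \<Phi>}"
    using assms fequiv.refl by (fastforce simp: fclass_def)
  then show ?thesis by simp
qed

lemma Q_fclass [simp]:
  assumes "\<Phi> \<in> fsquares B"
  shows "fclass B \<Phi> \<in> Arr (C1 (Q B))"
    "Dom (C1 (Q B)) (fclass B \<Phi>) = top_edge B \<Phi>" "Cod (C1 (Q B)) (fclass B \<Phi>) = bottom_edge B \<Phi>"
    "LeftA (Q B) (fclass B \<Phi>) = left_edge B \<Phi>" "RightA (Q B) (fclass B \<Phi>) = right_edge B \<Phi>"
  using assms fequiv_edges [of \<Phi>] by (auto simp: Q_def intro!: the_elem_fclass dest: sym)

text \<open>\<open>Vert_cong\<close> asks for both composites to be well-formed. Equivalent squares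
  share their edges by \<open>fequiv_edges\<close>, so this holds for all representatives once it
  holds for one.\<close>

lemma Q_VComp [simp]:
  assumes "\<Psi> \<in> fsquares B" "\<Phi> \<in> fsquares B" "bottom_edge B \<Phi> = top_edge B \<Psi>"
  shows "fclass B \<Psi> \<bullet>\<^bsub>Q B\<^esub> fclass B \<Phi> = fclass B (Vert \<Psi> \<Phi>)"
proof -
  have "fclass B (Vert \<Psi>' \<Phi>') = fclass B (Vert \<Psi> \<Phi>)" if "fequiv B \<Psi> \<Psi>'" "fequiv B \<Phi> \<Phi>'" for \<Psi>' \<Phi>'
    using that assms fequiv_edges [OF that(1)] fequiv_edges [OF that(2)]
    by (intro fclass_eqI fequiv.Vert_cong) (auto intro: fequiv.sym)
  then show ?thesis
    using fclass_UN2 [of \<Psi> \<Phi> "\<lambda>\<Psi> \<Phi>. fclass B (Vert \<Psi> \<Phi>)"] assms by (simp add: Q_def)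
qed

lemma Q_HComp [simp]:
  assumes "\<Psi> \<in> fsquares B" "\<Phi> \<in> fsquares B" "right_edge B \<Phi> = left_edge B \<Psi>"
  shows "fclass B \<Psi> \<star>\<^bsub>Q B\<^esub> fclass B \<Phi> = fclass B (Horiz \<Psi> \<Phi>)"
proof -
  have "fclass B (Horiz \<Psi>' \<Phi>') = fclass B (Horiz \<Psi> \<Phi>)" if "fequiv B \<Psi> \<Psi>'" "fequiv B \<Phi> \<Phi>'" for \<Psi>' \<Phi>'
    using that assms fequiv_edges [OF that(1)] fequiv_edges [OF that(2)]
    by (intro fclass_eqI fequiv.Horiz_cong) (auto intro: fequiv.sym)
  then show ?thesis
    using fclass_UN2 [of \<Psi> \<Phi> "\<lambda>\<Psi> \<Phi>. fclass B (Horiz \<Psi> \<Phi>)"] assms by (simp add: Q_def)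
qed

lemma Q_C1_category: "category (C1 (Q B))"
proof
  fix f assume "f \<in> Arr (C1 (Q B))"
  then show "Dom (C1 (Q B)) f \<in> Obj (C1 (Q B))" "Cod (C1 (Q B)) f \<in> Obj (C1 (Q B))"
    "Idn (C1 (Q B)) (Cod (C1 (Q B)) f) \<bullet>\<^bsub>Q B\<^esub> f = f" "f \<bullet>\<^bsub>Q B\<^esub> Idn (C1 (Q B)) (Dom (C1 (Q B)) f) = f"
    \<comment> \<open>Classes are sets; with \<open>equalityI\<close> removed, their equations are
      not split into inclusions and remain in reach of \<open>fclass_eqI\<close>.\<close>
    by (auto simp: Q_Arr fclass_eqI fequiv.Vert_id_bottom fequiv.Vert_id_top del: equalityI)
next
  fix a assume "a \<in> Obj (C1 (Q B))"
  then show "in_hom (C1 (Q B)) (Idn (C1 (Q B)) a) a a" by (simp add: in_hom_def)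
next
  fix f g a b c assume "in_hom (C1 (Q B)) f a b" "in_hom (C1 (Q B)) g b c"
  then show "in_hom (C1 (Q B)) (g \<bullet>\<^bsub>Q B\<^esub> f) a c"
    by (auto simp: in_hom_def Q_Arr)
next
  fix f g h a b c d
  assume "in_hom (C1 (Q B)) f a b" "in_hom (C1 (Q B)) g b c" "in_hom (C1 (Q B)) h c d"
  then show "(h \<bullet>\<^bsub>Q B\<^esub> g) \<bullet>\<^bsub>Q B\<^esub> f = h \<bullet>\<^bsub>Q B\<^esub> (g \<bullet>\<^bsub>Q B\<^esub> f)"
    by (auto simp: in_hom_def Q_Arr intro!: fclass_eqI fequiv.Vert_assoc del: equalityI)
qed

text \<open>Together with \<open>Q_cell_HComp\<close> this makes classes of cells compose as in
  \<open>B\<close>, so that identities between 2-cells pass to \<open>Q B\<close>.\<close>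

lemma Q_cell_VComp:
  assumes "\<phi> \<in> Cell2 B" "\<psi> \<in> Cell2 B" "Dom (Hom B) \<psi> = Cod (Hom B) \<phi>"
  shows "fclass B (Cell \<psi>) \<bullet>\<^bsub>Q B\<^esub> fclass B (Cell \<phi>) = fclass B (Cell (\<psi> \<cdot>\<^bsub>B\<^esub> \<phi>))"
  using assms by (auto simp: in_hom_def intro!: fclass_eqI fequiv.Vert_cells del: equalityI)

lemma Q_cell_HComp:
  assumes "\<psi> \<in> Cell2 B" "\<phi> \<in> Cell2 B" "Src B (Dom (Hom B) \<psi>) = Tgt B (Dom (Hom B) \<phi>)"
  shows "fclass B (Cell \<psi>) \<star>\<^bsub>Q B\<^esub> fclass B (Cell \<phi>) = fclass B (Cell (\<psi> \<otimes>\<^bsub>B\<^esub> \<phi>))"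
  using assms by (auto simp: composable2_def composable1_def intro!: fclass_eqI fequiv.Horiz_cells del: equalityI)

lemma Q_cell_inverse:
  assumes "inverse_arrows (Hom B) \<phi> \<psi>"
  shows "inverse_arrows (C1 (Q B)) (fclass B (Cell \<phi>)) (fclass B (Cell \<psi>))"
  using assms by (auto simp: inverse_arrows_def in_hom_def Q_cell_VComp simp del: Q_VComp)

lemma Q_cell_invertible:
  "invertible_arrow (Hom B) \<phi> \<Longrightarrow> invertible_arrow (C1 (Q B)) (fclass B (Cell \<phi>))"
  unfolding invertible_arrow_def using Q_cell_inverse by blast

lemma Q_cell_globular: "\<phi> \<in> Cell2 B \<Longrightarrow> globular (Q B) (fclass B (Cell \<phi>))"
  by (simp add: globular_def)

section \<open>The axioms of a double category for \<open>Q B\<close>\<close>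

lemma Q_Left_functor: "cat_functor (C1 (Q B)) (C0 (Q B)) (LeftO (Q B)) (LeftA (Q B))"
  using Q_C1_category Dec.category_axioms
  by (auto simp: cat_functor_def cat_functor_axioms_def in_hom_def Q_Arr)

lemma Q_Right_functor: "cat_functor (C1 (Q B)) (C0 (Q B)) (RightO (Q B)) (RightA (Q B))"
  using Q_C1_category Dec.category_axioms
  by (auto simp: cat_functor_def cat_functor_axioms_def in_hom_def Q_Arr)

lemma Q_HId_functor: "cat_functor (C0 (Q B)) (C1 (Q B)) (HIdO (Q B)) (HIdA (Q B))"
  using Q_C1_category Dec.category_axioms
  by (auto simp: cat_functor_def cat_functor_axioms_def in_hom_def
      intro!: fclass_eqI fequiv.unit_cell fequiv.sym [OF fequiv.Vert_HIdSq] del: equalityI)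

lemma Q_HComp_functor: "cat_functor (hpairs_cat (Q B)) (C1 (Q B))
      (\<lambda>(\<beta>, \<alpha>). \<beta> \<ast>\<^bsub>Q B\<^esub> \<alpha>) (\<lambda>(\<Psi>, \<Phi>). \<Psi> \<star>\<^bsub>Q B\<^esub> \<Phi>)"
proof (intro cat_functor.intro cat_functor_axioms.intro hpairs_category Q_C1_category
    Q_Left_functor Q_Right_functor)
  fix a assume "a \<in> Obj (hpairs_cat (Q B))"
  then show "(case Idn (hpairs_cat (Q B)) a of (\<Psi>, \<Phi>) \<Rightarrow> \<Psi> \<star>\<^bsub>Q B\<^esub> \<Phi>)
      = Idn (C1 (Q B)) (case a of (\<beta>, \<alpha>) \<Rightarrow> \<beta> \<ast>\<^bsub>Q B\<^esub> \<alpha>)"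
    by (auto simp: hcompO_def Q_cell_HComp HComp2_Idn simp del: Q_HComp)
next
  fix f g a b c assume "in_hom (hpairs_cat (Q B)) f a b" "in_hom (hpairs_cat (Q B)) g b c"
  then show "(case Comp (hpairs_cat (Q B)) g f of (\<Psi>, \<Phi>) \<Rightarrow> \<Psi> \<star>\<^bsub>Q B\<^esub> \<Phi>)
      = (case g of (\<Psi>, \<Phi>) \<Rightarrow> \<Psi> \<star>\<^bsub>Q B\<^esub> \<Phi>) \<bullet>\<^bsub>Q B\<^esub> (case f of (\<Psi>, \<Phi>) \<Rightarrow> \<Psi> \<star>\<^bsub>Q B\<^esub> \<Phi>)"
    by (auto simp: in_hom_def hcompA_def Q_Arr intro!: fclass_eqI fequiv.interchange del: equalityI)
qed (auto simp: in_hom_def hcompO_def hcompA_def Q_Arr fsquares_matching Dec.category_axioms)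

lemma Q_double_category: "double_category (Q B)"
proof (intro double_category.intro Q_Left_functor Q_Right_functor Q_HId_functor Q_HComp_functor)
  fix \<Xi> \<Psi> \<Phi> assume "hcompA (Q B) \<Xi> \<Psi>" "hcompA (Q B) \<Psi> \<Phi>"
  then obtain x y z where "\<Xi> = fclass B x" "\<Psi> = fclass B y" "\<Phi> = fclass B z"
    and wf: "x \<in> fsquares B" "y \<in> fsquares B" "z \<in> fsquares B"
      "right_edge B y = left_edge B x" "right_edge B z = left_edge B y"
    by (auto simp: hcompA_def Q_Arr)
  then show "DAssoc (Q B) (Cod (C1 (Q B)) \<Xi>) (Cod (C1 (Q B)) \<Psi>) (Cod (C1 (Q B)) \<Phi>)
        \<bullet>\<^bsub>Q B\<^esub> ((\<Xi> \<star>\<^bsub>Q B\<^esub> \<Psi>) \<star>\<^bsub>Q B\<^esub> \<Phi>)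
      = (\<Xi> \<star>\<^bsub>Q B\<^esub> (\<Psi> \<star>\<^bsub>Q B\<^esub> \<Phi>))
        \<bullet>\<^bsub>Q B\<^esub> DAssoc (Q B) (Dom (C1 (Q B)) \<Xi>) (Dom (C1 (Q B)) \<Psi>) (Dom (C1 (Q B)) \<Phi>)"
    using fsquares_matching [OF wf(2,1)] fsquares_matching [OF wf(3,2)]
    by (simp add: fclass_eqI fequiv.Assoc_natural)
next
  fix \<Phi> \<alpha> \<beta> assume "in_hom (C1 (Q B)) \<Phi> \<alpha> \<beta>"
  then obtain x where "\<Phi> = fclass B x" "x \<in> fsquares B" "\<alpha> = top_edge B x" "\<beta> = bottom_edge B x"
    by (auto simp: in_hom_def Q_Arr)
  then show "DLUnit (Q B) \<beta> \<bullet>\<^bsub>Q B\<^esub> (HIdA (Q B) (RightA (Q B) \<Phi>) \<star>\<^bsub>Q B\<^esub> \<Phi>) = \<Phi> \<bullet>\<^bsub>Q B\<^esub> DLUnit (Q B) \<alpha>"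
    "DRUnit (Q B) \<beta> \<bullet>\<^bsub>Q B\<^esub> (\<Phi> \<star>\<^bsub>Q B\<^esub> HIdA (Q B) (LeftA (Q B) \<Phi>)) = \<Phi> \<bullet>\<^bsub>Q B\<^esub> DRUnit (Q B) \<alpha>"
    by (simp_all add: fclass_eqI fequiv.LUnit_natural fequiv.RUnit_natural)
next
  fix \<delta> \<gamma> \<beta> \<alpha> assume h: "hcompO (Q B) \<delta> \<gamma>" "hcompO (Q B) \<gamma> \<beta>" "hcompO (Q B) \<beta> \<alpha>"
  then show "DAssoc (Q B) \<delta> \<gamma> (\<beta> \<ast>\<^bsub>Q B\<^esub> \<alpha>) \<bullet>\<^bsub>Q B\<^esub> DAssoc (Q B) (\<delta> \<ast>\<^bsub>Q B\<^esub> \<gamma>) \<beta> \<alpha>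
      = (Idn (C1 (Q B)) \<delta> \<star>\<^bsub>Q B\<^esub> DAssoc (Q B) \<gamma> \<beta> \<alpha>) \<bullet>\<^bsub>Q B\<^esub> DAssoc (Q B) \<delta> (\<gamma> \<ast>\<^bsub>Q B\<^esub> \<beta>) \<alpha>
          \<bullet>\<^bsub>Q B\<^esub> (DAssoc (Q B) \<delta> \<gamma> \<beta> \<star>\<^bsub>Q B\<^esub> Idn (C1 (Q B)) \<alpha>)"
    \<comment> \<open>Only cells occur, so each side collapses to a single cell and the pentagon of
      \<open>B\<close> identifies the two; the triangle below is treated likewise.\<close>
    using pentagon [of \<delta> \<gamma> \<beta> \<alpha>]
    by (simp add: hcompO_def composable1_def Q_cell_HComp Q_cell_VComp del: Q_VComp Q_HComp)
next
  fix \<beta> \<alpha> assume "hcompO (Q B) \<beta> \<alpha>"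
  then show "(Idn (C1 (Q B)) \<beta> \<star>\<^bsub>Q B\<^esub> DLUnit (Q B) \<alpha>)
        \<bullet>\<^bsub>Q B\<^esub> DAssoc (Q B) \<beta> (HIdO (Q B) (RightO (Q B) \<alpha>)) \<alpha>
      = DRUnit (Q B) \<beta> \<star>\<^bsub>Q B\<^esub> Idn (C1 (Q B)) \<alpha>"
    using triangle [of \<beta> \<alpha>]
    by (simp add: hcompO_def composable1_def Q_cell_HComp Q_cell_VComp del: Q_VComp Q_HComp)
qed (auto simp: hcompO_def hcompA_def Q_Arr in_hom_def composable1_def
    intro!: Q_cell_globular Q_cell_invertible Assoc_invertible LUnit_invertible RUnit_invertible)

sublocale Q: double_category "Q B"
  by (rule Q_double_category)

text \<open>\<open>Q_simps\<close> turns identities of \<open>Q B\<close> into classes of identity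
  cells, a form in which \<open>Comp_Idn\<close> no longer matches.\<close>

lemma Q_Id_VComp [simp]:
  assumes "X \<in> Arr (C1 (Q B))"
  shows "Cod (C1 (Q B)) X = \<alpha> \<Longrightarrow> fclass B (Cell (Id2 B \<alpha>)) \<bullet>\<^bsub>Q B\<^esub> X = X"
    "Dom (C1 (Q B)) X = \<alpha> \<Longrightarrow> X \<bullet>\<^bsub>Q B\<^esub> fclass B (Cell (Id2 B \<alpha>)) = X"
  using Q.C1.Comp_Idn [OF assms] by simp_all

text \<open>
  From here on squares are combined by the operations of \<open>Q B\<close>; replacing these by formal composites
  of representatives would hide the cells to which \<open>Q_cell_VComp\<close> and \<open>Q_cell_HComp\<close> apply.
\<close>

declare Q_VComp [simp del] Q_HComp [simp del]

end

subsection \<open>The extension of a decorated pseudofunctor\<close>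

context decorated_pseudofunctor
begin

lemma G_simps [simp]:
  "a \<in> Cell0 B \<Longrightarrow> P0 G a \<in> Cell0 B'"
  "\<alpha> \<in> Cell1 B \<Longrightarrow> P1 G \<alpha> \<in> Cell1 B'"
  "\<alpha> \<in> Cell1 B \<Longrightarrow> Src B' (P1 G \<alpha>) = P0 G (Src B \<alpha>)"
  "\<alpha> \<in> Cell1 B \<Longrightarrow> Tgt B' (P1 G \<alpha>) = P0 G (Tgt B \<alpha>)"
  "\<phi> \<in> Cell2 B \<Longrightarrow> P2 G \<phi> \<in> Cell2 B'"
  "\<phi> \<in> Cell2 B \<Longrightarrow> Dom (Hom B') (P2 G \<phi>) = P1 G (Dom (Hom B) \<phi>)"
  "\<phi> \<in> Cell2 B \<Longrightarrow> Cod (Hom B') (P2 G \<phi>) = P1 G (Cod (Hom B) \<phi>)"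
  "\<alpha> \<in> Cell1 B \<Longrightarrow> P2 G (Id2 B \<alpha>) = Id2 B' (P1 G \<alpha>)"
  "f \<in> Arr (Dec B) \<Longrightarrow> PV G f \<in> Arr (Dec B')"
  "f \<in> Arr (Dec B) \<Longrightarrow> Dom (Dec B') (PV G f) = P0 G (Dom (Dec B) f)"
  "f \<in> Arr (Dec B) \<Longrightarrow> Cod (Dec B') (PV G f) = P0 G (Cod (Dec B) f)"
  "a \<in> Cell0 B \<Longrightarrow> PV G (Idn (Dec B) a) = Idn (Dec B') (P0 G a)"
  using Loc.map_Obj Loc.map_Idn Dec.map_Idn P0_Cell0 P1_Src P1_Tgt
    cat_functor_simps [OF Loc.cat_functor_axioms] cat_functor_simps [OF Dec.cat_functor_axioms]
  by simp_all

lemma PV_Comp [simp]: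
  assumes "f \<in> Arr (Dec B)" "g \<in> Arr (Dec B)" "Dom (Dec B) g = Cod (Dec B) f"
  shows "PV G (Comp (Dec B) g f) = Comp (Dec B') (PV G g) (PV G f)"
  using assms by (rule cat_functor_Comp [OF Dec.cat_functor_axioms])

lemma P2_VComp:
  assumes "\<phi> \<in> Cell2 B" "\<psi> \<in> Cell2 B" "Dom (Hom B) \<psi> = Cod (Hom B) \<phi>"
  shows "P2 G (\<psi> \<cdot>\<^bsub>B\<^esub> \<phi>) = P2 G \<psi> \<cdot>\<^bsub>B'\<^esub> P2 G \<phi>"
  using assms by (rule cat_functor_Comp [OF Loc.cat_functor_axioms])

lemma PEta_simps [simp]:
  assumes "a \<in> Cell0 B"
  shows "PEta G a \<in> Cell2 B'" "Dom (Hom B') (PEta G a) = Unit1 B' (P0 G a)"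
    "Cod (Hom B') (PEta G a) = P1 G (Unit1 B a)"
  using PEta_hom [OF assms] by (simp_all add: in_hom_def)

lemma PMu_simps [simp]:
  assumes "\<beta> \<in> Cell1 B" "\<alpha> \<in> Cell1 B" "Src B \<beta> = Tgt B \<alpha>"
  shows "PMu G \<beta> \<alpha> \<in> Cell2 B'" "Dom (Hom B') (PMu G \<beta> \<alpha>) = P1 G \<beta> \<odot>\<^bsub>B'\<^esub> P1 G \<alpha>"
    "Cod (Hom B') (PMu G \<beta> \<alpha>) = P1 G (\<beta> \<odot>\<^bsub>B\<^esub> \<alpha>)" "invertible_arrow (Hom B') (PMu G \<beta> \<alpha>)"
  using PMu_hom [of \<beta> \<alpha>] PMu_invertible [of \<beta> \<alpha>] assms
  by (simp_all add: in_hom_def composable1_def)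

declare PEta_invertible [simp]

lemmas PEta_inverse [simp] = B'.Hom.inverse_arrow_simps [OF PEta_invertible]
lemmas PMu_inverse [simp] = B'.Hom.inverse_arrow_simps [OF PMu_simps(4)]

text \<open>The conjugating coherence cells change horizontal edges from units and composites of
  images to images of units and composites; being cells, they contribute only identities to the
  vertical edges.\<close>

lemma Q_ext_edges:
  assumes "\<Phi> \<in> fsquares B"
  shows "Q_ext B B' G \<Phi> \<in> fsquares B'
    \<and> top_edge B' (Q_ext B B' G \<Phi>) = P1 G (top_edge B \<Phi>)
    \<and> bottom_edge B' (Q_ext B B' G \<Phi>) = P1 G (bottom_edge B \<Phi>)
    \<and> left_edge B' (Q_ext B B' G \<Phi>) = PV G (left_edge B \<Phi>)
    \<and> right_edge B' (Q_ext B B' G \<Phi>) = PV G (right_edge B \<Phi>)"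
  using assms by induction (simp_all add: B.fsquares_matching)

lemmas Q_ext_simps [simp] =
  Q_ext_edges [THEN conjunct1] Q_ext_edges [THEN conjunct2, THEN conjunct1]
  Q_ext_edges [THEN conjunct2, THEN conjunct2, THEN conjunct1]
  Q_ext_edges [THEN conjunct2, THEN conjunct2, THEN conjunct2, THEN conjunct1]
  Q_ext_edges [THEN conjunct2, THEN conjunct2, THEN conjunct2, THEN conjunct2]

section \<open>Naturality of the coherence cells of \<open>G\<close> with respect to formal
  squares\<close>

abbreviation cell :: "'t \<Rightarrow> ('w, 't) fsquare set" where
  "cell \<phi> \<equiv> fclass B' (Cell \<phi>)"

text \<open>The argument is an expression and not a class, since invariance under
  \<open>fequiv B\<close> is established only in \<open>ext_fequiv\<close>. The value is already a
  class, so the axioms of \<open>Q B'\<close> apply to it.\<close>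

definition ext :: "('v, 's) fsquare \<Rightarrow> ('w, 't) fsquare set" where
  "ext \<Phi> = fclass B' (Q_ext B B' G \<Phi>)"

lemma ext_simps [simp]:
  assumes "\<Phi> \<in> fsquares B"
  shows "ext \<Phi> \<in> Arr (C1 (Q B'))"
    "Dom (C1 (Q B')) (ext \<Phi>) = P1 G (top_edge B \<Phi>)"
    "Cod (C1 (Q B')) (ext \<Phi>) = P1 G (bottom_edge B \<Phi>)"
    "LeftA (Q B') (ext \<Phi>) = PV G (left_edge B \<Phi>)"
    "RightA (Q B') (ext \<Phi>) = PV G (right_edge B \<Phi>)"
  using assms by (simp_all add: ext_def)

lemma ext_Cell [simp]: "ext (Cell \<phi>) = cell (P2 G \<phi>)"
  by (simp add: ext_def)

lemma ext_Vert [simp]: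
  assumes "\<Psi> \<in> fsquares B" "\<Phi> \<in> fsquares B" "bottom_edge B \<Phi> = top_edge B \<Psi>"
  shows "ext (Vert \<Psi> \<Phi>) = ext \<Psi> \<bullet>\<^bsub>Q B'\<^esub> ext \<Phi>"
  using assms by (simp add: ext_def B'.Q_VComp)

lemma ext_Horiz:
  assumes "\<Psi> \<in> fsquares B" "\<Phi> \<in> fsquares B" "right_edge B \<Phi> = left_edge B \<Psi>"
  shows "ext (Horiz \<Psi> \<Phi>) = cell (PMu G (bottom_edge B \<Psi>) (bottom_edge B \<Phi>))
    \<bullet>\<^bsub>Q B'\<^esub> (ext \<Psi> \<star>\<^bsub>Q B'\<^esub> ext \<Phi>)
    \<bullet>\<^bsub>Q B'\<^esub> cell (inverse_arrow (Hom B') (PMu G (top_edge B \<Psi>) (top_edge B \<Phi>)))"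
  using assms B.fsquares_matching [of \<Phi> \<Psi>]
  by (simp add: ext_def B'.Q_VComp B'.Q_HComp)

text \<open>Composing \<open>ext_Horiz\<close> with \<mu> at the top cancels the inverse. Later
  arguments use this inverse-free form, and \<open>ext_HIdSq_natural\<close> is its analogue for
  \<eta>.\<close>

lemma ext_Horiz_natural:
  assumes "\<Psi> \<in> fsquares B" "\<Phi> \<in> fsquares B" "right_edge B \<Phi> = left_edge B \<Psi>"
  shows "ext (Horiz \<Psi> \<Phi>) \<bullet>\<^bsub>Q B'\<^esub> cell (PMu G (top_edge B \<Psi>) (top_edge B \<Phi>))
    = cell (PMu G (bottom_edge B \<Psi>) (bottom_edge B \<Phi>)) \<bullet>\<^bsub>Q B'\<^esub> (ext \<Psi> \<star>\<^bsub>Q B'\<^esub> ext \<Phi>)"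
  using assms B.fsquares_matching [OF assms(2,1)]
  by (simp add: ext_Horiz B'.Q.C1.assoc B'.Q_cell_VComp)

lemma ext_HIdSq_natural:
  assumes "f \<in> Arr (Dec B)"
  shows "ext (HIdSq f) \<bullet>\<^bsub>Q B'\<^esub> cell (PEta G (Dom (Dec B) f))
    = cell (PEta G (Cod (Dec B) f)) \<bullet>\<^bsub>Q B'\<^esub> fclass B' (HIdSq (PV G f))"
proof -
  have "ext (HIdSq f) = cell (PEta G (Cod (Dec B) f)) \<bullet>\<^bsub>Q B'\<^esub> fclass B' (HIdSq (PV G f))
      \<bullet>\<^bsub>Q B'\<^esub> cell (inverse_arrow (Hom B') (PEta G (Dom (Dec B) f)))"
    using assms by (simp add: ext_def B'.Q_VComp)
  then show ?thesis
    using assms by (simp add: B'.Q.C1.assoc B'.Q_cell_VComp)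
qed

text \<open>Here and in the next lemma a further square \<open>X\<close> lies on top, for use inside
  right-nested composites.\<close>

lemma ext_Horiz_natural_assoc:
  assumes "\<Psi> \<in> fsquares B" "\<Phi> \<in> fsquares B" "right_edge B \<Phi> = left_edge B \<Psi>"
    and "X \<in> Arr (C1 (Q B'))" "Cod (C1 (Q B')) X = P1 G (top_edge B \<Psi>) \<odot>\<^bsub>B'\<^esub> P1 G (top_edge B \<Phi>)"
  shows "ext (Horiz \<Psi> \<Phi>) \<bullet>\<^bsub>Q B'\<^esub> cell (PMu G (top_edge B \<Psi>) (top_edge B \<Phi>)) \<bullet>\<^bsub>Q B'\<^esub> X
    = cell (PMu G (bottom_edge B \<Psi>) (bottom_edge B \<Phi>)) \<bullet>\<^bsub>Q B'\<^esub> (ext \<Psi> \<star>\<^bsub>Q B'\<^esub> ext \<Phi>) \<bullet>\<^bsub>Q B'\<^esub> X"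
  using assms B.fsquares_matching [OF assms(2,1)] ext_Horiz_natural [OF assms(1-3)]
  by (simp flip: B'.Q.C1.assoc)

lemma ext_HIdSq_natural_assoc:
  assumes "f \<in> Arr (Dec B)"
    and "X \<in> Arr (C1 (Q B'))" "Cod (C1 (Q B')) X = Unit1 B' (P0 G (Dom (Dec B) f))"
  shows "ext (HIdSq f) \<bullet>\<^bsub>Q B'\<^esub> cell (PEta G (Dom (Dec B) f)) \<bullet>\<^bsub>Q B'\<^esub> X
    = cell (PEta G (Cod (Dec B) f)) \<bullet>\<^bsub>Q B'\<^esub> fclass B' (HIdSq (PV G f)) \<bullet>\<^bsub>Q B'\<^esub> X"
  using assms ext_HIdSq_natural [OF assms(1)] by (simp flip: B'.Q.C1.assoc)

lemma cell_epi:
  assumes "invertible_arrow (Hom B') \<phi>" "\<phi> \<in> Cell2 B'" "X \<in> Arr (C1 (Q B'))" "Y \<in> Arr (C1 (Q B'))"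
    and "Dom (C1 (Q B')) X = Cod (Hom B') \<phi>" "Dom (C1 (Q B')) Y = Cod (Hom B') \<phi>"
    and "X \<bullet>\<^bsub>Q B'\<^esub> cell \<phi> = Y \<bullet>\<^bsub>Q B'\<^esub> cell \<phi>"
  shows "X = Y"
  by (rule B'.Q.C1.invertible_epi [OF B'.Q_cell_invertible [OF assms(1)]]) (use assms in simp_all)

section \<open>The coherence axioms of \<open>G\<close> inside \<open>Q B'\<close>\<close>

lemma cell_PMu_assoc:
  assumes "\<gamma> \<in> Cell1 B" "\<beta> \<in> Cell1 B" "\<alpha> \<in> Cell1 B" "Src B \<gamma> = Tgt B \<beta>" "Src B \<beta> = Tgt B \<alpha>"
  shows "cell (P2 G (Assoc B \<gamma> \<beta> \<alpha>)) \<bullet>\<^bsub>Q B'\<^esub> cell (PMu G (\<gamma> \<odot>\<^bsub>B\<^esub> \<beta>) \<alpha>)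
        \<bullet>\<^bsub>Q B'\<^esub> (cell (PMu G \<gamma> \<beta>) \<star>\<^bsub>Q B'\<^esub> cell (Id2 B' (P1 G \<alpha>)))
    = cell (PMu G \<gamma> (\<beta> \<odot>\<^bsub>B\<^esub> \<alpha>)) \<bullet>\<^bsub>Q B'\<^esub> (cell (Id2 B' (P1 G \<gamma>)) \<star>\<^bsub>Q B'\<^esub> cell (PMu G \<beta> \<alpha>))
        \<bullet>\<^bsub>Q B'\<^esub> cell (Assoc B' (P1 G \<gamma>) (P1 G \<beta>) (P1 G \<alpha>))"
  using PMu_assoc [of \<gamma> \<beta> \<alpha>] assms
  by (simp add: composable1_def B'.Q_cell_VComp B'.Q_cell_HComp)

lemma cell_PMu_LUnit:
  assumes "\<alpha> \<in> Cell1 B"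
  shows "cell (P2 G (LUnit B \<alpha>)) \<bullet>\<^bsub>Q B'\<^esub> cell (PMu G (Unit1 B (Tgt B \<alpha>)) \<alpha>)
        \<bullet>\<^bsub>Q B'\<^esub> (cell (PEta G (Tgt B \<alpha>)) \<star>\<^bsub>Q B'\<^esub> cell (Id2 B' (P1 G \<alpha>)))
    = cell (LUnit B' (P1 G \<alpha>))"
  using PMu_LUnit [of \<alpha>] assms by (simp add: B'.Q_cell_VComp B'.Q_cell_HComp)

lemma cell_PMu_RUnit:
  assumes "\<alpha> \<in> Cell1 B"
  shows "cell (P2 G (RUnit B \<alpha>)) \<bullet>\<^bsub>Q B'\<^esub> cell (PMu G \<alpha> (Unit1 B (Src B \<alpha>)))
        \<bullet>\<^bsub>Q B'\<^esub> (cell (Id2 B' (P1 G \<alpha>)) \<star>\<^bsub>Q B'\<^esub> cell (PEta G (Src B \<alpha>)))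
    = cell (RUnit B' (P1 G \<alpha>))"
  using PMu_RUnit [of \<alpha>] assms by (simp add: B'.Q_cell_VComp B'.Q_cell_HComp)

section \<open>Preservation of the relations of \<open>Q B\<close>\<close>

lemma ext_unit_cell:
  assumes "a \<in> Cell0 B"
  shows "ext (HIdSq (Idn (Dec B) a)) = ext (Cell (Id2 B (Unit1 B a)))"
proof (rule cell_epi [OF PEta_invertible [OF assms]])
  \<comment> \<open>\<open>Q B'\<close> has the same unit relation, so after composition with \<eta>
    both sides are \<eta> itself.\<close>
  have "fclass B' (HIdSq (Idn (Dec B') (P0 G a))) = cell (Id2 B' (Unit1 B' (P0 G a)))"
    using assms by (intro B'.fclass_eqI fequiv.unit_cell) simp
  then show "ext (HIdSq (Idn (Dec B) a)) \<bullet>\<^bsub>Q B'\<^esub> cell (PEta G a)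
      = ext (Cell (Id2 B (Unit1 B a))) \<bullet>\<^bsub>Q B'\<^esub> cell (PEta G a)"
    using assms ext_HIdSq_natural [of "Idn (Dec B) a"] by simp
qed (use assms in simp_all)

text \<open>\<eta> slides past the image of \<open>HIdSq f\<close> and then past that of
  \<open>HIdSq g\<close>; what remains is functoriality of horizontal identities in
  \<open>Q B'\<close>.\<close>

lemma ext_Vert_HIdSq:
  assumes "f \<in> Arr (Dec B)" "g \<in> Arr (Dec B)" "Dom (Dec B) g = Cod (Dec B) f"
  shows "ext (Vert (HIdSq g) (HIdSq f)) = ext (HIdSq (Comp (Dec B) g f))"
proof (rule cell_epi [OF PEta_invertible [of "Dom (Dec B) f"]])
  have "fclass B' (HIdSq (PV G g)) \<bullet>\<^bsub>Q B'\<^esub> fclass B' (HIdSq (PV G f))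
      = fclass B' (HIdSq (Comp (Dec B') (PV G g) (PV G f)))"
    using cat_functor_Comp [OF B'.Q.HId_functor, of "PV G f" "PV G g"] assms by simp
  then show "ext (Vert (HIdSq g) (HIdSq f)) \<bullet>\<^bsub>Q B'\<^esub> cell (PEta G (Dom (Dec B) f))
      = ext (HIdSq (Comp (Dec B) g f)) \<bullet>\<^bsub>Q B'\<^esub> cell (PEta G (Dom (Dec B) f))"
    using assms ext_HIdSq_natural [of f] ext_HIdSq_natural [of "Comp (Dec B) g f"]
      ext_HIdSq_natural_assoc [of g "fclass B' (HIdSq (PV G f))"]
    by (simp add: B'.Q.C1.assoc)
qed (use assms in simp_all)

text \<open>For two cells, sliding \<mu> past them is the naturality \<open>PMu_natural\<close> of
  \<open>G\<close> itself.\<close>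

lemma ext_Horiz_cells:
  assumes "\<psi> \<in> Cell2 B" "\<phi> \<in> Cell2 B" "Src B (Dom (Hom B) \<psi>) = Tgt B (Dom (Hom B) \<phi>)"
  shows "ext (Horiz (Cell \<psi>) (Cell \<phi>)) = ext (Cell (\<psi> \<otimes>\<^bsub>B\<^esub> \<phi>))"
proof (rule cell_epi [OF PMu_simps(4) [of "Dom (Hom B) \<psi>" "Dom (Hom B) \<phi>"]])
  show "ext (Horiz (Cell \<psi>) (Cell \<phi>)) \<bullet>\<^bsub>Q B'\<^esub> cell (PMu G (Dom (Hom B) \<psi>) (Dom (Hom B) \<phi>))
      = ext (Cell (\<psi> \<otimes>\<^bsub>B\<^esub> \<phi>)) \<bullet>\<^bsub>Q B'\<^esub> cell (PMu G (Dom (Hom B) \<psi>) (Dom (Hom B) \<phi>))"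
    using assms ext_Horiz_natural [of "Cell \<psi>" "Cell \<phi>"] PMu_natural [of \<psi> \<phi>]
    by (simp add: composable1_def composable2_def B'.Q_cell_VComp B'.Q_cell_HComp)
qed (use assms in simp_all)

text \<open>\<mu> slides past the composed columns at once on one side, and past the upper and then
  the lower row on the other; interchange in \<open>Q B'\<close> compares the results.\<close>

lemma ext_interchange:
  assumes \<Psi>: "\<Psi>\<^sub>1 \<in> fsquares B" "\<Psi>\<^sub>2 \<in> fsquares B" "bottom_edge B \<Psi>\<^sub>1 = top_edge B \<Psi>\<^sub>2"
    and \<Phi>: "\<Phi>\<^sub>1 \<in> fsquares B" "\<Phi>\<^sub>2 \<in> fsquares B" "bottom_edge B \<Phi>\<^sub>1 = top_edge B \<Phi>\<^sub>2"
    and h: "right_edge B \<Phi>\<^sub>1 = left_edge B \<Psi>\<^sub>1" "right_edge B \<Phi>\<^sub>2 = left_edge B \<Psi>\<^sub>2"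
  shows "ext (Horiz (Vert \<Psi>\<^sub>2 \<Psi>\<^sub>1) (Vert \<Phi>\<^sub>2 \<Phi>\<^sub>1)) = ext (Vert (Horiz \<Psi>\<^sub>2 \<Phi>\<^sub>2) (Horiz \<Psi>\<^sub>1 \<Phi>\<^sub>1))"
proof (rule cell_epi [OF PMu_simps(4) [of "top_edge B \<Psi>\<^sub>1" "top_edge B \<Phi>\<^sub>1"]])
  note m = B.fsquares_matching [OF \<Phi>(1) \<Psi>(1) h(1)] B.fsquares_matching [OF \<Phi>(2) \<Psi>(2) h(2)]
  note n = ext_Horiz_natural [OF \<Psi>(1) \<Phi>(1) h(1)] ext_Horiz_natural [OF \<Psi>(2) \<Phi>(2) h(2)]
  let ?t = "cell (PMu G (top_edge B \<Psi>\<^sub>1) (top_edge B \<Phi>\<^sub>1))"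
  let ?m = "cell (PMu G (top_edge B \<Psi>\<^sub>2) (top_edge B \<Phi>\<^sub>2))"
  let ?b = "cell (PMu G (bottom_edge B \<Psi>\<^sub>2) (bottom_edge B \<Phi>\<^sub>2))"
  have "ext (Horiz (Vert \<Psi>\<^sub>2 \<Psi>\<^sub>1) (Vert \<Phi>\<^sub>2 \<Phi>\<^sub>1)) \<bullet>\<^bsub>Q B'\<^esub> ?t
      = ?b \<bullet>\<^bsub>Q B'\<^esub> ((ext \<Psi>\<^sub>2 \<bullet>\<^bsub>Q B'\<^esub> ext \<Psi>\<^sub>1) \<star>\<^bsub>Q B'\<^esub> (ext \<Phi>\<^sub>2 \<bullet>\<^bsub>Q B'\<^esub> ext \<Phi>\<^sub>1))"
    using assms ext_Horiz_natural [of "Vert \<Psi>\<^sub>2 \<Psi>\<^sub>1" "Vert \<Phi>\<^sub>2 \<Phi>\<^sub>1"] by simp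
  also have "\<dots> = (?b \<bullet>\<^bsub>Q B'\<^esub> (ext \<Psi>\<^sub>2 \<star>\<^bsub>Q B'\<^esub> ext \<Phi>\<^sub>2)) \<bullet>\<^bsub>Q B'\<^esub> (ext \<Psi>\<^sub>1 \<star>\<^bsub>Q B'\<^esub> ext \<Phi>\<^sub>1)"
    using assms m by (simp add: B'.Q.C1.assoc B'.Q.interchange)
  also have "\<dots> = ext (Horiz \<Psi>\<^sub>2 \<Phi>\<^sub>2) \<bullet>\<^bsub>Q B'\<^esub> (?m \<bullet>\<^bsub>Q B'\<^esub> (ext \<Psi>\<^sub>1 \<star>\<^bsub>Q B'\<^esub> ext \<Phi>\<^sub>1))"
    using assms m n(2) by (simp flip: B'.Q.C1.assoc)
  also have "\<dots> = ext (Vert (Horiz \<Psi>\<^sub>2 \<Phi>\<^sub>2) (Horiz \<Psi>\<^sub>1 \<Phi>\<^sub>1)) \<bullet>\<^bsub>Q B'\<^esub> ?t"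
    using assms m n(1) by (simp add: B'.Q.C1.assoc)
  finally show "ext (Horiz (Vert \<Psi>\<^sub>2 \<Psi>\<^sub>1) (Vert \<Phi>\<^sub>2 \<Phi>\<^sub>1)) \<bullet>\<^bsub>Q B'\<^esub> ?t
      = ext (Vert (Horiz \<Psi>\<^sub>2 \<Phi>\<^sub>2) (Horiz \<Psi>\<^sub>1 \<Phi>\<^sub>1)) \<bullet>\<^bsub>Q B'\<^esub> ?t" .
qed (use assms B.fsquares_matching [OF \<Phi>(1) \<Psi>(1) h(1)] B.fsquares_matching [OF \<Phi>(2) \<Psi>(2) h(2)]
  in simp_all)

text \<open>Both sides are composed with \<mu> and then with \<eta> whiskered by an identity, to be
  cancelled at the end. On the left, naturality moves these to the bottom, where
  \<open>cell_PMu_LUnit\<close> merges them with the image of the unitor into a unitor of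
  \<open>Q B'\<close>; naturality of the latter carries \<open>ext \<Phi>\<close> across, and
  \<open>cell_PMu_LUnit\<close> unfolds it again at the top.\<close>

lemma ext_LUnit_natural:
  assumes "\<Phi> \<in> fsquares B"
  shows "ext (Vert (Cell (LUnit B (bottom_edge B \<Phi>))) (Horiz (HIdSq (right_edge B \<Phi>)) \<Phi>))
    = ext (Vert \<Phi> (Cell (LUnit B (top_edge B \<Phi>))))" (is "ext ?L = ext ?R")
proof -
  let ?a = "top_edge B \<Phi>" and ?b = "bottom_edge B \<Phi>" and ?r = "right_edge B \<Phi>"
  let ?i = "fclass B' (HIdSq (PV G ?r))"
  let ?ma = "cell (PMu G (Unit1 B (Tgt B ?a)) ?a)" and ?mb = "cell (PMu G (Unit1 B (Tgt B ?b)) ?b)"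
  let ?ea = "cell (PEta G (Tgt B ?a))" and ?eb = "cell (PEta G (Tgt B ?b))"
  let ?j = "\<lambda>\<alpha>. cell (Id2 B' (P1 G \<alpha>))"
  let ?l = "\<lambda>\<alpha>. cell (P2 G (LUnit B \<alpha>))"
  have "ext ?L \<bullet>\<^bsub>Q B'\<^esub> ?ma = ?l ?b \<bullet>\<^bsub>Q B'\<^esub> ?mb \<bullet>\<^bsub>Q B'\<^esub> (ext (HIdSq ?r) \<star>\<^bsub>Q B'\<^esub> ext \<Phi>)"
    using assms ext_Horiz_natural [of "HIdSq ?r" \<Phi>] by (simp add: B'.Q.C1.assoc)
  \<comment> \<open>The identity beside \<eta> passes from the top to the bottom of
    \<open>ext \<Phi>\<close>, preparing the split by interchange in the next step.\<close>
  then have "(ext ?L \<bullet>\<^bsub>Q B'\<^esub> ?ma) \<bullet>\<^bsub>Q B'\<^esub> (?ea \<star>\<^bsub>Q B'\<^esub> ?j ?a)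
      = ?l ?b \<bullet>\<^bsub>Q B'\<^esub> ?mb \<bullet>\<^bsub>Q B'\<^esub> ((ext (HIdSq ?r) \<bullet>\<^bsub>Q B'\<^esub> ?ea) \<star>\<^bsub>Q B'\<^esub> (?j ?b \<bullet>\<^bsub>Q B'\<^esub> ext \<Phi>))"
    using assms by (simp add: B'.Q.C1.assoc B'.Q.interchange)
  also have "\<dots> = (?l ?b \<bullet>\<^bsub>Q B'\<^esub> ?mb \<bullet>\<^bsub>Q B'\<^esub> (?eb \<star>\<^bsub>Q B'\<^esub> ?j ?b)) \<bullet>\<^bsub>Q B'\<^esub> (?i \<star>\<^bsub>Q B'\<^esub> ext \<Phi>)"
    using assms ext_HIdSq_natural [of ?r] by (simp add: B'.Q.C1.assoc B'.Q.interchange)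
  also have "\<dots> = cell (LUnit B' (P1 G ?b)) \<bullet>\<^bsub>Q B'\<^esub> (?i \<star>\<^bsub>Q B'\<^esub> ext \<Phi>)"
    using assms by (simp only: cell_PMu_LUnit B.fsquares_edges_simps)
  also have "\<dots> = ext \<Phi> \<bullet>\<^bsub>Q B'\<^esub> cell (LUnit B' (P1 G ?a))"
    using B'.Q.DLUnit_natural [of "ext \<Phi>" "P1 G ?a" "P1 G ?b"] assms by (simp add: in_hom_def)
  also have "\<dots> = ext \<Phi> \<bullet>\<^bsub>Q B'\<^esub> ?l ?a \<bullet>\<^bsub>Q B'\<^esub> ?ma \<bullet>\<^bsub>Q B'\<^esub> (?ea \<star>\<^bsub>Q B'\<^esub> ?j ?a)"
    using assms by (simp only: cell_PMu_LUnit B.fsquares_edges_simps)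
  also have "\<dots> = (ext ?R \<bullet>\<^bsub>Q B'\<^esub> ?ma) \<bullet>\<^bsub>Q B'\<^esub> (?ea \<star>\<^bsub>Q B'\<^esub> ?j ?a)"
    using assms by (simp add: B'.Q.C1.assoc)
  \<comment> \<open>The whiskered \<eta> is rewritten as one cell, the shape that
    \<open>cell_epi\<close> cancels.\<close>
  finally have "(ext ?L \<bullet>\<^bsub>Q B'\<^esub> ?ma) \<bullet>\<^bsub>Q B'\<^esub> cell (PEta G (Tgt B ?a) \<otimes>\<^bsub>B'\<^esub> Id2 B' (P1 G ?a))
      = (ext ?R \<bullet>\<^bsub>Q B'\<^esub> ?ma) \<bullet>\<^bsub>Q B'\<^esub> cell (PEta G (Tgt B ?a) \<otimes>\<^bsub>B'\<^esub> Id2 B' (P1 G ?a))"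
    using assms by (simp add: B'.Q_cell_HComp)
  then have "ext ?L \<bullet>\<^bsub>Q B'\<^esub> ?ma = ext ?R \<bullet>\<^bsub>Q B'\<^esub> ?ma"
    \<comment> \<open>The rotation brings the equation, the last premise of \<open>cell_epi\<close>,
      to the front to receive the chained fact.\<close>
    by (rule cell_epi [rotated 6])
      (use assms in \<open>simp_all add: B'.HComp2_invertible B'.Hom.Idn_invertible\<close>)
  then show ?thesis
    by (rule cell_epi [rotated 6]) (use assms in simp_all)
qed

text \<open>Mirror image of the argument for the left unitor: \<eta> now sits in the left column and
  is absorbed by \<open>cell_PMu_RUnit\<close>.\<close>

lemma ext_RUnit_natural:
  assumes "\<Phi> \<in> fsquares B"
  shows "ext (Vert (Cell (RUnit B (bottom_edge B \<Phi>))) (Horiz \<Phi> (HIdSq (left_edge B \<Phi>))))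
    = ext (Vert \<Phi> (Cell (RUnit B (top_edge B \<Phi>))))" (is "ext ?L = ext ?R")
proof -
  let ?a = "top_edge B \<Phi>" and ?b = "bottom_edge B \<Phi>" and ?f = "left_edge B \<Phi>"
  let ?i = "fclass B' (HIdSq (PV G ?f))"
  let ?ma = "cell (PMu G ?a (Unit1 B (Src B ?a)))" and ?mb = "cell (PMu G ?b (Unit1 B (Src B ?b)))"
  let ?ea = "cell (PEta G (Src B ?a))" and ?eb = "cell (PEta G (Src B ?b))"
  let ?j = "\<lambda>\<alpha>. cell (Id2 B' (P1 G \<alpha>))"
  let ?r = "\<lambda>\<alpha>. cell (P2 G (RUnit B \<alpha>))"
  have "ext ?L \<bullet>\<^bsub>Q B'\<^esub> ?ma = ?r ?b \<bullet>\<^bsub>Q B'\<^esub> ?mb \<bullet>\<^bsub>Q B'\<^esub> (ext \<Phi> \<star>\<^bsub>Q B'\<^esub> ext (HIdSq ?f))"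
    using assms ext_Horiz_natural [of \<Phi> "HIdSq ?f"] by (simp add: B'.Q.C1.assoc)
  then have "(ext ?L \<bullet>\<^bsub>Q B'\<^esub> ?ma) \<bullet>\<^bsub>Q B'\<^esub> (?j ?a \<star>\<^bsub>Q B'\<^esub> ?ea)
      = ?r ?b \<bullet>\<^bsub>Q B'\<^esub> ?mb \<bullet>\<^bsub>Q B'\<^esub> ((?j ?b \<bullet>\<^bsub>Q B'\<^esub> ext \<Phi>) \<star>\<^bsub>Q B'\<^esub> (ext (HIdSq ?f) \<bullet>\<^bsub>Q B'\<^esub> ?ea))"
    using assms by (simp add: B'.Q.C1.assoc B'.Q.interchange)
  also have "\<dots> = (?r ?b \<bullet>\<^bsub>Q B'\<^esub> ?mb \<bullet>\<^bsub>Q B'\<^esub> (?j ?b \<star>\<^bsub>Q B'\<^esub> ?eb)) \<bullet>\<^bsub>Q B'\<^esub> (ext \<Phi> \<star>\<^bsub>Q B'\<^esub> ?i)"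
    using assms ext_HIdSq_natural [of ?f] by (simp add: B'.Q.C1.assoc B'.Q.interchange)
  also have "\<dots> = cell (RUnit B' (P1 G ?b)) \<bullet>\<^bsub>Q B'\<^esub> (ext \<Phi> \<star>\<^bsub>Q B'\<^esub> ?i)"
    using assms by (simp only: cell_PMu_RUnit B.fsquares_edges_simps)
  also have "\<dots> = ext \<Phi> \<bullet>\<^bsub>Q B'\<^esub> cell (RUnit B' (P1 G ?a))"
    using B'.Q.DRUnit_natural [of "ext \<Phi>" "P1 G ?a" "P1 G ?b"] assms by (simp add: in_hom_def)
  also have "\<dots> = ext \<Phi> \<bullet>\<^bsub>Q B'\<^esub> ?r ?a \<bullet>\<^bsub>Q B'\<^esub> ?ma \<bullet>\<^bsub>Q B'\<^esub> (?j ?a \<star>\<^bsub>Q B'\<^esub> ?ea)"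
    using assms by (simp only: cell_PMu_RUnit B.fsquares_edges_simps)
  also have "\<dots> = (ext ?R \<bullet>\<^bsub>Q B'\<^esub> ?ma) \<bullet>\<^bsub>Q B'\<^esub> (?j ?a \<star>\<^bsub>Q B'\<^esub> ?ea)"
    using assms by (simp add: B'.Q.C1.assoc)
  finally have "(ext ?L \<bullet>\<^bsub>Q B'\<^esub> ?ma) \<bullet>\<^bsub>Q B'\<^esub> cell (Id2 B' (P1 G ?a) \<otimes>\<^bsub>B'\<^esub> PEta G (Src B ?a))
      = (ext ?R \<bullet>\<^bsub>Q B'\<^esub> ?ma) \<bullet>\<^bsub>Q B'\<^esub> cell (Id2 B' (P1 G ?a) \<otimes>\<^bsub>B'\<^esub> PEta G (Src B ?a))"
    using assms by (simp add: B'.Q_cell_HComp)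
  then have "ext ?L \<bullet>\<^bsub>Q B'\<^esub> ?ma = ext ?R \<bullet>\<^bsub>Q B'\<^esub> ?ma"
    by (rule cell_epi [rotated 6])
      (use assms in \<open>simp_all add: B'.HComp2_invertible B'.Hom.Idn_invertible\<close>)
  then show ?thesis
    by (rule cell_epi [rotated 6]) (use assms in simp_all)
qed

text \<open>The left side is composed with the two coherence cells of a left-nested triple. They
  slide to the bottom, where \<open>cell_PMu_assoc\<close> trades the image of the associator for an
  associator of \<open>Q B'\<close>, which passes the triple composite by naturality. The coherence
  cells, now nested to the right, climb back to the top, and \<open>cell_PMu_assoc\<close> there
  yields the right side.\<close>

lemma ext_Assoc_natural:
  assumes wf: "\<Xi> \<in> fsquares B" "\<Psi> \<in> fsquares B" "\<Phi> \<in> fsquares B"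
    and h: "right_edge B \<Psi> = left_edge B \<Xi>" "right_edge B \<Phi> = left_edge B \<Psi>"
  shows "ext (Vert (Cell (Assoc B (bottom_edge B \<Xi>) (bottom_edge B \<Psi>) (bottom_edge B \<Phi>)))
      (Horiz (Horiz \<Xi> \<Psi>) \<Phi>))
    = ext (Vert (Horiz \<Xi> (Horiz \<Psi> \<Phi>))
      (Cell (Assoc B (top_edge B \<Xi>) (top_edge B \<Psi>) (top_edge B \<Phi>))))" (is "ext ?L = ext ?R")
proof -
  note m [simp] = B.fsquares_matching [OF wf(2,1) h(1)] B.fsquares_matching [OF wf(3,2) h(2)]
  note [simp] = wf h
  \<comment> \<open>The horizontal edges are folded into names, so that boundary conditions met by
    the simplifier reduce to the list of facts that follows.\<close>
  define x y z where "x = top_edge B \<Xi>" and "y = top_edge B \<Psi>" and "z = top_edge B \<Phi>"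
  define x' y' z'
    where "x' = bottom_edge B \<Xi>" and "y' = bottom_edge B \<Psi>" and "z' = bottom_edge B \<Phi>"
  note d [simp] = x_def [symmetric] y_def [symmetric] z_def [symmetric]
    x'_def [symmetric] y'_def [symmetric] z'_def [symmetric]
  have [simp]: "x \<in> Cell1 B" "y \<in> Cell1 B" "z \<in> Cell1 B" "x' \<in> Cell1 B" "y' \<in> Cell1 B" "z' \<in> Cell1 B"
    "Src B x = Tgt B y" "Src B y = Tgt B z" "Src B x' = Tgt B y'" "Src B y' = Tgt B z'"
    by (simp_all add: x_def y_def z_def x'_def y'_def z'_def del: d)
  let ?j = "\<lambda>\<alpha>. cell (Id2 B' (P1 G \<alpha>))"
  let ?a = "\<lambda>\<gamma> \<beta> \<alpha>. cell (P2 G (Assoc B \<gamma> \<beta> \<alpha>))"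
  let ?a' = "\<lambda>\<gamma> \<beta> \<alpha>. cell (Assoc B' (P1 G \<gamma>) (P1 G \<beta>) (P1 G \<alpha>))"
  let ?m = "\<lambda>\<beta> \<alpha>. cell (PMu G \<beta> \<alpha>)"
  have "(ext ?L \<bullet>\<^bsub>Q B'\<^esub> ?m (x \<odot>\<^bsub>B\<^esub> y) z) \<bullet>\<^bsub>Q B'\<^esub> (?m x y \<star>\<^bsub>Q B'\<^esub> ?j z)
      = ?a x' y' z' \<bullet>\<^bsub>Q B'\<^esub> (ext (Horiz (Horiz \<Xi> \<Psi>) \<Phi>) \<bullet>\<^bsub>Q B'\<^esub> ?m (x \<odot>\<^bsub>B\<^esub> y) z)
          \<bullet>\<^bsub>Q B'\<^esub> (?m x y \<star>\<^bsub>Q B'\<^esub> ?j z)"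
    by (simp add: B'.Q.C1.assoc)
  \<comment> \<open>The outer \<mu> slides down; the identity beside the inner one moves to the
    bottom of \<open>ext \<Phi>\<close> for the next use of interchange.\<close>
  also have "\<dots> = ?a x' y' z' \<bullet>\<^bsub>Q B'\<^esub> ?m (x' \<odot>\<^bsub>B\<^esub> y') z'
      \<bullet>\<^bsub>Q B'\<^esub> ((ext (Horiz \<Xi> \<Psi>) \<bullet>\<^bsub>Q B'\<^esub> ?m x y) \<star>\<^bsub>Q B'\<^esub> (?j z' \<bullet>\<^bsub>Q B'\<^esub> ext \<Phi>))"
    using ext_Horiz_natural_assoc [of "Horiz \<Xi> \<Psi>" \<Phi> "?m x y \<star>\<^bsub>Q B'\<^esub> ?j z"] by (simp add: B'.Q.C1.assoc B'.Q.interchange)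
  also have "\<dots> = (?a x' y' z' \<bullet>\<^bsub>Q B'\<^esub> ?m (x' \<odot>\<^bsub>B\<^esub> y') z' \<bullet>\<^bsub>Q B'\<^esub> (?m x' y' \<star>\<^bsub>Q B'\<^esub> ?j z'))
      \<bullet>\<^bsub>Q B'\<^esub> ((ext \<Xi> \<star>\<^bsub>Q B'\<^esub> ext \<Psi>) \<star>\<^bsub>Q B'\<^esub> ext \<Phi>)"
    using ext_Horiz_natural [of \<Xi> \<Psi>] by (simp add: B'.Q.C1.assoc B'.Q.interchange)
  also have "\<dots> = (?m x' (y' \<odot>\<^bsub>B\<^esub> z') \<bullet>\<^bsub>Q B'\<^esub> (?j x' \<star>\<^bsub>Q B'\<^esub> ?m y' z') \<bullet>\<^bsub>Q B'\<^esub> ?a' x' y' z')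
      \<bullet>\<^bsub>Q B'\<^esub> ((ext \<Xi> \<star>\<^bsub>Q B'\<^esub> ext \<Psi>) \<star>\<^bsub>Q B'\<^esub> ext \<Phi>)"
    by (simp add: cell_PMu_assoc)
  also have "\<dots> = ?m x' (y' \<odot>\<^bsub>B\<^esub> z') \<bullet>\<^bsub>Q B'\<^esub> (?j x' \<star>\<^bsub>Q B'\<^esub> ?m y' z')
      \<bullet>\<^bsub>Q B'\<^esub> (ext \<Xi> \<star>\<^bsub>Q B'\<^esub> (ext \<Psi> \<star>\<^bsub>Q B'\<^esub> ext \<Phi>)) \<bullet>\<^bsub>Q B'\<^esub> ?a' x y z"
    using B'.Q.DAssoc_natural [of "ext \<Xi>" "ext \<Psi>" "ext \<Phi>"]
    by (simp add: hcompA_def B'.Q.C1.assoc)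
  \<comment> \<open>The inner \<mu> climbs back first, and the identity beside it moves to the top
    of \<open>ext \<Xi>\<close>.\<close>
  also have "\<dots> = ?m x' (y' \<odot>\<^bsub>B\<^esub> z')
      \<bullet>\<^bsub>Q B'\<^esub> ((ext \<Xi> \<bullet>\<^bsub>Q B'\<^esub> ?j x) \<star>\<^bsub>Q B'\<^esub> (ext (Horiz \<Psi> \<Phi>) \<bullet>\<^bsub>Q B'\<^esub> ?m y z)) \<bullet>\<^bsub>Q B'\<^esub> ?a' x y z"
    using ext_Horiz_natural [of \<Psi> \<Phi>] by (simp add: B'.Q.interchange flip: B'.Q.C1.assoc)
  also have "\<dots> = (ext (Horiz \<Xi> (Horiz \<Psi> \<Phi>)) \<bullet>\<^bsub>Q B'\<^esub> ?m x (y \<odot>\<^bsub>B\<^esub> z))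
      \<bullet>\<^bsub>Q B'\<^esub> (?j x \<star>\<^bsub>Q B'\<^esub> ?m y z) \<bullet>\<^bsub>Q B'\<^esub> ?a' x y z"
    using ext_Horiz_natural_assoc
      [of \<Xi> "Horiz \<Psi> \<Phi>" "(?j x \<star>\<^bsub>Q B'\<^esub> ?m y z) \<bullet>\<^bsub>Q B'\<^esub> ?a' x y z"]
      B'.Q.interchange [of "?j x" "ext \<Xi>" "?m y z" "ext (Horiz \<Psi> \<Phi>)", symmetric]
    by (simp add: B'.Q.C1.assoc)
  also have "\<dots> = ext (Horiz \<Xi> (Horiz \<Psi> \<Phi>))
      \<bullet>\<^bsub>Q B'\<^esub> ?m x (y \<odot>\<^bsub>B\<^esub> z) \<bullet>\<^bsub>Q B'\<^esub> (?j x \<star>\<^bsub>Q B'\<^esub> ?m y z) \<bullet>\<^bsub>Q B'\<^esub> ?a' x y z"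
    by (simp add: B'.Q.C1.assoc)
  also have "\<dots> = ext (Horiz \<Xi> (Horiz \<Psi> \<Phi>))
      \<bullet>\<^bsub>Q B'\<^esub> ?a x y z \<bullet>\<^bsub>Q B'\<^esub> ?m (x \<odot>\<^bsub>B\<^esub> y) z \<bullet>\<^bsub>Q B'\<^esub> (?m x y \<star>\<^bsub>Q B'\<^esub> ?j z)"
    by (simp add: cell_PMu_assoc)
  also have "\<dots> = (ext ?R \<bullet>\<^bsub>Q B'\<^esub> ?m (x \<odot>\<^bsub>B\<^esub> y) z) \<bullet>\<^bsub>Q B'\<^esub> (?m x y \<star>\<^bsub>Q B'\<^esub> ?j z)"
    by (simp add: B'.Q.C1.assoc)
  finally have "(ext ?L \<bullet>\<^bsub>Q B'\<^esub> ?m (x \<odot>\<^bsub>B\<^esub> y) z) \<bullet>\<^bsub>Q B'\<^esub> cell (PMu G x y \<otimes>\<^bsub>B'\<^esub> Id2 B' (P1 G z))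
      = (ext ?R \<bullet>\<^bsub>Q B'\<^esub> ?m (x \<odot>\<^bsub>B\<^esub> y) z) \<bullet>\<^bsub>Q B'\<^esub> cell (PMu G x y \<otimes>\<^bsub>B'\<^esub> Id2 B' (P1 G z))"
    by (simp add: B'.Q_cell_HComp)
  then have "ext ?L \<bullet>\<^bsub>Q B'\<^esub> ?m (x \<odot>\<^bsub>B\<^esub> y) z = ext ?R \<bullet>\<^bsub>Q B'\<^esub> ?m (x \<odot>\<^bsub>B\<^esub> y) z"
    by (rule cell_epi [rotated 6]) (simp_all add: B'.HComp2_invertible B'.Hom.Idn_invertible)
  then show ?thesis
    by (rule cell_epi [rotated 6]) simp_all
qed

lemma ext_fequiv:
  assumes "fequiv B \<Phi> \<Psi>"
  shows "ext \<Phi> = ext \<Psi>"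
  using assms
proof induction
  case (Horiz_cong \<Psi> \<Psi>' \<Phi> \<Phi>')
  then show ?case
    \<comment> \<open>Equivalent squares have equal edges, so the same coherence cells conjugate
      both composites.\<close>
    using B.fequiv_edges [of \<Psi> \<Psi>'] B.fequiv_edges [of \<Phi> \<Phi>'] by (simp add: ext_Horiz)
next
  case (Vert_assoc \<Xi> \<Psi> \<Phi>)
  then show ?case by (simp add: B'.Q.C1.assoc)
next
  case (Vert_cells \<phi> \<alpha> \<beta> \<psi> \<gamma>)
  then show ?case by (auto simp: in_hom_def P2_VComp B'.Q_cell_VComp)
next
  case (interchange \<Psi>\<^sub>2 \<Psi>\<^sub>1 \<Phi>\<^sub>2 \<Phi>\<^sub>1)
  then show ?case by (intro ext_interchange) simp_all
next
  case (Vert_HIdSq f a b g c)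
  then show ?case by (intro ext_Vert_HIdSq) (simp_all add: in_hom_def)
next
  case (Horiz_cells \<psi> \<phi>)
  then show ?case by (intro ext_Horiz_cells) (simp_all add: composable1_def composable2_def)
next
  case (Assoc_natural \<Xi> \<Psi> \<Phi>)
  then show ?case by (intro ext_Assoc_natural) simp_all
\<comment> \<open>The three lemmas match \<open>ext\<close> of whole expressions, so
  \<open>ext_Vert\<close> and \<open>ext_Cell\<close> stay off in the first pass; the second settles
  the congruence for \<open>Vert\<close> and the vertical identity relations.\<close>
qed (simp_all add: ext_unit_cell ext_LUnit_natural ext_RUnit_natural del: ext_Vert ext_Cell,
    simp_all)

section \<open>The double functor \<open>Q_fun B B' G\<close>\<close>

lemma Q_fun_simps [simp]:
  "FO (Q_fun B B' G) = P0 G" "FV (Q_fun B B' G) = PV G" "FH (Q_fun B B' G) = P1 G"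
  "FMu (Q_fun B B' G) \<beta> \<alpha> = cell (PMu G \<beta> \<alpha>)" "FEta (Q_fun B B' G) a = cell (PEta G a)"
  by (simp_all add: Q_fun_def)

lemma FS_Q_fun [simp]:
  assumes "\<Phi> \<in> fsquares B"
  shows "FS (Q_fun B B' G) (fclass B \<Phi>) = ext \<Phi>"
  using B.fclass_UN [OF assms, of ext] ext_fequiv by (auto simp: Q_fun_def ext_def)

lemma Q_fun_F1: "cat_functor (C1 (Q B)) (C1 (Q B')) (P1 G) (FS (Q_fun B B' G))"
proof (intro cat_functor.intro cat_functor_axioms.intro B.Q_C1_category B'.Q_C1_category)
  fix f g a b c assume "in_hom (C1 (Q B)) f a b" "in_hom (C1 (Q B)) g b c"
  then show "FS (Q_fun B B' G) (g \<bullet>\<^bsub>Q B\<^esub> f) = FS (Q_fun B B' G) g \<bullet>\<^bsub>Q B'\<^esub> FS (Q_fun B B' G) f"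
    by (auto simp: in_hom_def Q_Arr [of B] B.Q_VComp)
qed (auto simp: in_hom_def Q_Arr [of B])

text \<open>Naturality of the coherence data is \<open>ext_Horiz_natural\<close> and
  \<open>ext_HIdSq_natural\<close> at representatives; the coherence axioms are those of
  \<open>G\<close>, carried over by the \<open>cell_PMu\<close> lemmas.\<close>

lemma Q_fun_double_functor: "double_functor (Q B) (Q B') (Q_fun B B' G)"
proof (intro double_functor.intro double_functor_axioms.intro
    B.Q_double_category B'.Q_double_category)
  fix \<Psi> \<Phi> assume "hcompA (Q B) \<Psi> \<Phi>"
  then obtain x y where "\<Psi> = fclass B x" "\<Phi> = fclass B y"
    and wf: "x \<in> fsquares B" "y \<in> fsquares B" "right_edge B y = left_edge B x"
    by (auto simp: hcompA_def Q_Arr [of B])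
  then show "FMu (Q_fun B B' G) (Cod (C1 (Q B)) \<Psi>) (Cod (C1 (Q B)) \<Phi>)
        \<bullet>\<^bsub>Q B'\<^esub> (FS (Q_fun B B' G) \<Psi> \<star>\<^bsub>Q B'\<^esub> FS (Q_fun B B' G) \<Phi>)
      = FS (Q_fun B B' G) (\<Psi> \<star>\<^bsub>Q B\<^esub> \<Phi>)
        \<bullet>\<^bsub>Q B'\<^esub> FMu (Q_fun B B' G) (Dom (C1 (Q B)) \<Psi>) (Dom (C1 (Q B)) \<Phi>)"
    by (simp add: B.Q_HComp ext_Horiz_natural)
next
  fix f a b assume "in_hom (C0 (Q B)) f a b"
  then show "FEta (Q_fun B B' G) b \<bullet>\<^bsub>Q B'\<^esub> HIdA (Q B') (FV (Q_fun B B' G) f)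
      = FS (Q_fun B B' G) (HIdA (Q B) f) \<bullet>\<^bsub>Q B'\<^esub> FEta (Q_fun B B' G) a"
    using ext_HIdSq_natural [of f] by (auto simp: in_hom_def)
qed (use Q_fun_F1 Dec.cat_functor_axioms in \<open>auto simp: in_hom_def hcompO_def Q_Arr [of B]
    cell_PMu_assoc cell_PMu_LUnit cell_PMu_RUnit B'.Q_cell_globular B'.Q_cell_invertible\<close>)

end

subsection \<open>Uniqueness\<close>

lemma Hstar_simps [simp]: "VComp2 (Hstar C) = VCompA C"
  by (simp add: Hstar_def)

lemma dec_pf_comp_simps [simp]:
  "P0 (dec_pf_comp B'' K G) a = P0 K (P0 G a)" "P1 (dec_pf_comp B'' K G) \<alpha> = P1 K (P1 G \<alpha>)"
  "P2 (dec_pf_comp B'' K G) \<phi> = P2 K (P2 G \<phi>)" "PV (dec_pf_comp B'' K G) f = PV K (PV G f)"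
  "PMu (dec_pf_comp B'' K G) \<beta> \<alpha> = P2 K (PMu G \<beta> \<alpha>) \<cdot>\<^bsub>B''\<^esub> PMu K (P1 G \<beta>) (P1 G \<alpha>)"
  "PEta (dec_pf_comp B'' K G) a = P2 K (PEta G a) \<cdot>\<^bsub>B''\<^esub> PEta K (P0 G a)"
  by (simp_all add: dec_pf_comp_def)

lemma Hstar_fun_simps [simp]:
  "P0 (Hstar_fun F) = FO F" "P1 (Hstar_fun F) = FH F" "P2 (Hstar_fun F) = FS F"
  "PMu (Hstar_fun F) = FMu F" "PEta (Hstar_fun F) = FEta F" "PV (Hstar_fun F) = FV F"
  by (simp_all add: Hstar_fun_def)

lemma incl_simps [simp]:
  "P0 (incl B) a = a" "P1 (incl B) \<alpha> = \<alpha>" "P2 (incl B) \<phi> = fclass B (Cell \<phi>)" "PV (incl B) f = f"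
  "PMu (incl B) \<beta> \<alpha> = fclass B (Cell (Id2 B (\<beta> \<odot>\<^bsub>B\<^esub> \<alpha>)))"
  "PEta (incl B) a = fclass B (Cell (Id2 B (Unit1 B a)))"
  by (simp_all add: incl_def)

context decorated_pseudofunctor
begin

text \<open>The inclusions are strict and contribute only identity factors to composite coherence
  data. Once these are absorbed, the equation of pseudofunctors is a componentwise comparison with
  \<open>G\<close>.\<close>

lemma restricts_to_iff:
  assumes "double_functor (Q B) (Q B') F"
  shows "restricts_to B B' F G \<longleftrightarrow>
    (\<forall>a \<in> Cell0 B. FO F a = P0 G a \<and> FEta F a = cell (PEta G a)) \<and>
    (\<forall>\<alpha> \<in> Cell1 B. FH F \<alpha> = P1 G \<alpha>) \<and>
    (\<forall>\<phi> \<in> Cell2 B. FS F (fclass B (Cell \<phi>)) = cell (P2 G \<phi>)) \<and>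
    (\<forall>\<beta> \<alpha>. composable1 B \<beta> \<alpha> \<longrightarrow> FMu F \<beta> \<alpha> = cell (PMu G \<beta> \<alpha>)) \<and>
    (\<forall>f \<in> Arr (Dec B). FV F f = PV G f)"
proof -
  interpret F: double_functor "Q B" "Q B'" F by (rule assms)
  \<comment> \<open>\<open>F\<close> preserves identities, so the factor from \<open>incl B\<close>
    disappears; the one from \<open>incl B'\<close> is removed by \<open>Q_Id_VComp\<close>.\<close>
  have "FS F (fclass B (Cell (Id2 B (Unit1 B a)))) \<bullet>\<^bsub>Q B'\<^esub> FEta F a = FEta F a" if "a \<in> Cell0 B" for a
    using that F.FEta_hom [of a] F.F1.map_Idn [of "Unit1 B a"] F.F1.map_Obj [of "Unit1 B a"]
    by (simp add: in_hom_def)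
  moreover have "FS F (fclass B (Cell (Id2 B (\<beta> \<odot>\<^bsub>B\<^esub> \<alpha>)))) \<bullet>\<^bsub>Q B'\<^esub> FMu F \<beta> \<alpha> = FMu F \<beta> \<alpha>"
    if "composable1 B \<beta> \<alpha>" for \<beta> \<alpha>
    using that F.FMu_hom [of \<beta> \<alpha>] F.F1.map_Idn [of "\<beta> \<odot>\<^bsub>B\<^esub> \<alpha>"] F.F1.map_Obj [of "\<beta> \<odot>\<^bsub>B\<^esub> \<alpha>"]
    by (simp add: in_hom_def hcompO_def composable1_def)
  ultimately show ?thesis
    unfolding restricts_to_def dec_pf_eq_def by (simp add: composable1_def)
qed

lemma FS_unique:
  assumes F: "double_functor (Q B) (Q B') F" and G: "restricts_to B B' F G"
    and "\<Phi> \<in> fsquares B"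
  shows "FS F (fclass B \<Phi>) = ext \<Phi>"
proof -
  interpret F: double_functor "Q B" "Q B'" F by (rule F)
  \<comment> \<open>As rewrite rules these replace the components of \<open>F\<close>, coherence
    cells included, by those of \<open>G\<close>.\<close>
  note [simp] = restricts_to_iff [OF F, THEN iffD1, OF G, rule_format]
  note FS = cat_functor_simps [OF F.F1.cat_functor_axioms]
  show ?thesis
    using assms(3)
  proof induction
    case (1 \<phi>)
    then show ?case by simp
  next
    case (2 f)
    \<comment> \<open>Naturality of \<open>FEta F\<close> is the equation that characterises
      \<open>ext\<close> on \<open>HIdSq f\<close>; afterwards \<eta> cancels.\<close>
    have "FS F (fclass B (HIdSq f)) \<bullet>\<^bsub>Q B'\<^esub> cell (PEta G (Dom (Dec B) f))
        = ext (HIdSq f) \<bullet>\<^bsub>Q B'\<^esub> cell (PEta G (Dom (Dec B) f))"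
      using 2 F.FEta_natural [of f "Dom (Dec B) f" "Cod (Dec B) f"] ext_HIdSq_natural [of f]
      by (simp add: in_hom_def)
    then show ?case
      by (rule cell_epi [rotated 6]) (use 2 in \<open>simp_all add: FS\<close>)
  next
    case (3 \<Psi> \<Phi>)
    then show ?case
      using cat_functor_Comp [OF F.F1.cat_functor_axioms, of "fclass B \<Phi>" "fclass B \<Psi>"]
      by (simp add: B.Q_VComp)
  next
    case (4 \<Psi> \<Phi>)
    note m = B.fsquares_matching [OF 4(2,1,3)]
    \<comment> \<open>The same with naturality of \<open>FMu F\<close>; the induction hypotheses
      identify the two factors.\<close>
    have "FS F (fclass B (Horiz \<Psi> \<Phi>)) \<bullet>\<^bsub>Q B'\<^esub> cell (PMu G (top_edge B \<Psi>) (top_edge B \<Phi>))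
        = ext (Horiz \<Psi> \<Phi>) \<bullet>\<^bsub>Q B'\<^esub> cell (PMu G (top_edge B \<Psi>) (top_edge B \<Phi>))"
      using 4 m F.FMu_natural [of "fclass B \<Psi>" "fclass B \<Phi>"] ext_Horiz_natural [of \<Psi> \<Phi>]
      by (simp add: hcompA_def composable1_def B.Q_HComp)
    then show ?case
      by (rule cell_epi [rotated 6]) (use 4 m in \<open>simp_all add: FS\<close>)
  qed
qed

end

theorem theorem4p7:
  fixes B :: "('o, 'h, 's, 'v) dec_bicat"
    and B' :: "('p, 'k, 't, 'w) dec_bicat"
    and G :: "('o, 'p, 'h, 'k, 's, 't, 'v, 'w) dec_pseudofun"
  assumes "decorated_bicategory B"
    and "decorated_bicategory B'"
    and "decorated_pseudofunctor B B' G"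
  shows "double_functor (Q B) (Q B') (Q_fun B B' G)
    \<and> restricts_to B B' (Q_fun B B' G) G
    \<and> (\<forall>F. double_functor (Q B) (Q B') F \<and> restricts_to B B' F G
          \<longrightarrow> dblfun_eq (Q B) F (Q_fun B B' G))"
proof -
  interpret decorated_pseudofunctor B B' G by (rule assms(3))
  show ?thesis
  proof (intro conjI allI impI)
    show "double_functor (Q B) (Q B') (Q_fun B B' G)"
      by (rule Q_fun_double_functor)
    then show "restricts_to B B' (Q_fun B B' G) G"
      by (simp add: restricts_to_iff)
    fix F assume F: "double_functor (Q B) (Q B') F \<and> restricts_to B B' F G"
    then show "dblfun_eq (Q B) F (Q_fun B B' G)"
      \<comment> \<open>Every square of \<open>Q B\<close> is the class of an expression, where both
        functors take the value \<open>ext\<close> by \<open>FS_unique\<close> and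
        \<open>FS_Q_fun\<close>.\<close>
      using restricts_to_iff [of F] FS_unique [of F]
      by (auto simp: dblfun_eq_def Q_Arr [of B] hcompO_def composable1_def)
  qed
qed

end
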